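(* Let $(X,d,\mu)$ be a measured metric space, and let $\Gamma$ be a discrete subgroup of isometries of $(X,d,\mu)$ acting on $X$ freely, properly and measure-preservingly such that $\Gamma\backslash X$ is compact and $sys_\Gamma\ge 4$. Suppose $\mu(B(x,\frac12))\ge 1$ for all $x\in X$. Let the diameter and the volume of $\Gamma\backslash X$ be bounded above by $D$ and $V_0$, respectively. Let $\sigma\ge 1$ and suppose $(\Gamma\backslash X,\bar d,\bar\mu)$ satisfies a Poincaré inequality: for each $R\in(0,\frac{sys_\Gamma}{4}]$ there is a constant $C(R)>0$ such that for every $v\in C(\Gamma\backslash X)$, every upper gradient $g_v$ of $v$ and every $y\in\Gamma\backslash X$, $$\int_{B(y,R)}|v-v_R|^{\sigma}\,d\bar\mu\le C(R)\int_{B(y,R)}g_v^{\sigma}\,d\bar\mu .$$ Let $C=\sup\{C(R):0<R\le\frac{sys_\Gamma}{4}\}$. Then for every $u\in C(X)$, every upper gradient $g_u$ of $u$ and every $x\in X$, $$\int_{B(x,R)}|u-u_R|^{\sigma}\,d\mu\le 2^{4\sigma-2}\,C\,V_0\,\lambda^{4}R^{\sigma-1}F_\Gamma(2\lambda R)\int_{B(x,2\lambda R)}g_u^{\sigma}\,d\mu$$ for all $R\ge 4\lambda$, where $\lambda=V_0+D$.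
   Context: A measured metric space $(X,d,\mu)$ is a proper geodesic metric space $(X,d)$ (all closed balls are compact and any two points can be joined by a geodesic) together with a Borel measure $\mu$ on $X$ such that every closed ball has finite positive measure. $B(x,R)$ is the open ball of radius $R$ about $x$. $C(X)$ is the space of continuous real functions on $X$. An upper gradient of $u\in C(X)$ is a Borel function $g_u:X\to[0,\infty]$ such that for each curve $\gamma:[0,1]\to X$ of finite length $l(\gamma)$ and constant speed, $|u(\gamma(1))-u(\gamma(0))|\le l(\gamma)\int_0^1 g_u(\gamma(t))\,dt$; similarly on $\Gamma\backslash X$. $u_R(x)=\frac{1}{\mu(B(x,R))}\int_{B(x,R)}u\,d\mu$; inside an integral over $B(x,R)$, $u_R$ denotes the constant $u_R(x)$; similarly on $\Gamma\backslash X$ with $\bar\mu$. Quotient structures: let $p:X\to\Gamma\backslash X$ be the quotient map. The quotient metric is $\bar d(p(\tilde x),p(\tilde y))=\inf_{\gamma\in\Gamma}d(\tilde x,\gamma\tilde y)$. The systole is $sys_\Gamma=\inf_{x\in X}\inf_{\gamma\ne e}d(x,\gamma x)$; it is positive, and $p$ is a covering map which restricts to an isometry from $B(\tilde x,\frac{sys_\Gamma}{4})$ onto $B(p(\tilde x),\frac{sys_\Gamma}{4})$ for each $\tilde x\in X$. The quotient measure $\bar\mu$ is the Borel measure on $\Gamma\backslash X$ for which $p$ restricted to each ball $B(\tilde x,\frac{sys_\Gamma}{4})$ is measure preserving; the volume of $\Gamma\backslash X$ is $\bar\mu(\Gamma\backslash X)$. Growth of $\Gamma$: $F_\Gamma(R)=|\Gamma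 x\cap\overline{B(x,R)}|$, where $|\cdot|$ is cardinality (the paper treats this as independent of $x$; in the inequality one may take $x$ to be the centre of the ball). *)

theory Defs
  imports "HOL-Analysis.Analysis" "HOL-Algebra.Bij"
begin

section \<open>Measured metric spaces\<close>

text \<open>Spaces are given by a carrier set and a distance function (locale \<open>Metric_space\<close>), so that
  the notions below apply both to \<open>X\<close> and to the orbit space of a group acting on \<open>X\<close>.\<close>

definition metric_borel :: "'a set \<Rightarrow> ('a \<Rightarrow> 'a \<Rightarrow> real) \<Rightarrow> 'a measure" where
  "metric_borel M d = sigma M {U. openin (Metric_space.mtopology M d) U}"

text \<open>Closed balls are meant to have positive radius: for radius \<open>0\<close> they are points, which
  are allowed to be null sets.\<close>

locale measured_metric_space = Metric_space M d
  for M :: "'a set" and d :: "'a \<Rightarrow> 'a \<Rightarrow> real" +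
  fixes \<mu> :: "'a measure"
  assumes proper: "\<And>x r. x \<in> M \<Longrightarrow> compactin mtopology (mcball x r)"
    and geodesic: "\<And>x y. x \<in> M \<Longrightarrow> y \<in> M \<Longrightarrow>
      \<exists>c. c \<in> {0..d x y} \<rightarrow> M \<and> c 0 = x \<and> c (d x y) = y \<and>
          (\<forall>s\<in>{0..d x y}. \<forall>t\<in>{0..d x y}. d (c s) (c t) = \<bar>s - t\<bar>)"
    and borel_sets: "sets \<mu> = sets (metric_borel M d)"
    and mcball_measure: "\<And>x r. x \<in> M \<Longrightarrow> 0 < r \<Longrightarrow>
      0 < emeasure \<mu> (mcball x r) \<and> emeasure \<mu> (mcball x r) < \<infinity>"

text \<open>Extended real, so that an empty carrier and unbounded spaces need no convention.\<close>

definition metric_diameter :: "'a set \<Rightarrow> ('a \<Rightarrow> 'a \<Rightarrow> real) \<Rightarrow> ereal" where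
  "metric_diameter M d = (SUP x\<in>M. SUP y\<in>M. ereal (d x y))"

definition ball_average ::
    "'a set \<Rightarrow> ('a \<Rightarrow> 'a \<Rightarrow> real) \<Rightarrow> 'a measure \<Rightarrow> ('a \<Rightarrow> real) \<Rightarrow> real \<Rightarrow> 'a \<Rightarrow> real" where
  "ball_average M d \<mu> u R x =
     (1 / measure \<mu> (Metric_space.mball M d x R)) * (LINT z:Metric_space.mball M d x R|\<mu>. u z)"


section \<open>Upper gradients\<close>

text \<open>Supremum over all finite subdivisions \<open>t\<^sub>0 \<le> \<dots> \<le> t\<^sub>n\<close> of \<open>[a, b]\<close>. Requiring
  \<open>t\<^sub>0 = a\<close> and \<open>t\<^sub>n = b\<close> would give the same supremum.\<close>

definition curve_length :: "('a \<Rightarrow> 'a \<Rightarrow> real) \<Rightarrow> (real \<Rightarrow> 'a) \<Rightarrow> real \<Rightarrow> real \<Rightarrow> ennreal" where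
  "curve_length d c a b =
     (SUP ts\<in>{ts. sorted ts \<and> set ts \<subseteq> {a..b}}.
        \<Sum>i<length ts - 1. ennreal (d (c (ts ! i)) (c (ts ! Suc i))))"

definition constant_speed :: "('a \<Rightarrow> 'a \<Rightarrow> real) \<Rightarrow> (real \<Rightarrow> 'a) \<Rightarrow> bool" where
  "constant_speed d c \<longleftrightarrow>
     (\<forall>s t. 0 \<le> s \<and> s \<le> t \<and> t \<le> 1 \<longrightarrow>
        curve_length d c s t = ennreal (t - s) * curve_length d c 0 1)"

definition upper_gradient ::
    "'a set \<Rightarrow> ('a \<Rightarrow> 'a \<Rightarrow> real) \<Rightarrow> ('a \<Rightarrow> real) \<Rightarrow> ('a \<Rightarrow> ennreal) \<Rightarrow> bool" where
  "upper_gradient M d u g \<longleftrightarrow>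
     g \<in> borel_measurable (metric_borel M d) \<and>
     (\<forall>c. pathin (Metric_space.mtopology M d) c \<and> curve_length d c 0 1 < \<infinity> \<and> constant_speed d c \<longrightarrow>
        ennreal \<bar>u (c 1) - u (c 0)\<bar>
          \<le> curve_length d c 0 1 * (\<integral>\<^sup>+t\<in>{0..1}. g (c t) \<partial>lborel))"

text \<open>Powers of \<open>[0, \<infinity>]\<close>-valued functions; only used for exponents \<open>s > 0\<close>.\<close>

definition ennreal_powr :: "ennreal \<Rightarrow> real \<Rightarrow> ennreal" where
  "ennreal_powr a s = (if a = \<infinity> then \<infinity> else ennreal (enn2real a powr s))"


section \<open>Isometric group actions\<close>

definition isometry_group :: "'a set \<Rightarrow> ('a \<Rightarrow> 'a \<Rightarrow> real) \<Rightarrow> ('a \<Rightarrow> 'a) monoid" where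
  "isometry_group M d =
     BijGroup M \<lparr>carrier := {f \<in> Bij M. \<forall>x\<in>M. \<forall>y\<in>M. d (f x) (f y) = d x y}\<rparr>"

text \<open>The topology of pointwise convergence agrees with the compact-open topology on a group of
  isometries. The neutral element of \<open>isometry_group M d\<close> is \<open>\<lambda>x\<in>M. x\<close>, since the elements
  of \<open>BijGroup M\<close> are extensional. Since \<open>\<Gamma>\<close> is discrete, its compact subsets are the finite
  ones, whence the form of \<open>proper_action\<close>.\<close>

locale isometric_action = measured_metric_space M d \<mu>
  for M :: "'a set" and d :: "'a \<Rightarrow> 'a \<Rightarrow> real" and \<mu> :: "'a measure" +
  fixes \<Gamma> :: "('a \<Rightarrow> 'a) set"
  assumes subgroup_isometries: "subgroup \<Gamma> (isometry_group M d)"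
    and discrete_group:
      "subtopology (product_topology (\<lambda>_. mtopology) M) \<Gamma> = discrete_topology \<Gamma>"
    and free_action: "\<And>\<gamma> x. \<gamma> \<in> \<Gamma> \<Longrightarrow> \<gamma> \<noteq> \<one>\<^bsub>isometry_group M d\<^esub> \<Longrightarrow> x \<in> M \<Longrightarrow> \<gamma> x \<noteq> x"
    and proper_action: "\<And>K. compactin mtopology K \<Longrightarrow> finite {\<gamma> \<in> \<Gamma>. \<gamma> ` K \<inter> K \<noteq> {}}"
    and measure_preserving: "\<And>\<gamma> A. \<gamma> \<in> \<Gamma> \<Longrightarrow> A \<in> sets \<mu> \<Longrightarrow> emeasure \<mu> (\<gamma> ` A) = emeasure \<mu> A"

text \<open>For the trivial group the systole is \<open>\<infinity>\<close>, an infimum over the empty set.\<close>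

definition systole :: "'a set \<Rightarrow> ('a \<Rightarrow> 'a \<Rightarrow> real) \<Rightarrow> ('a \<Rightarrow> 'a) set \<Rightarrow> ereal" where
  "systole M d \<Gamma> = (INF x\<in>M. INF \<gamma>\<in>\<Gamma> - {\<one>\<^bsub>isometry_group M d\<^esub>}. ereal (d x (\<gamma> x)))"

definition orbit_map :: "('a \<Rightarrow> 'a) set \<Rightarrow> 'a \<Rightarrow> 'a set" where
  "orbit_map \<Gamma> x = (\<lambda>\<gamma>. \<gamma> x) ` \<Gamma>"

definition orbit_space :: "'a set \<Rightarrow> ('a \<Rightarrow> 'a) set \<Rightarrow> 'a set set" where
  "orbit_space M \<Gamma> = orbit_map \<Gamma> ` M"

text \<open>The choice of representatives is immaterial, see \<open>quotient_dist_orbit_map\<close> below. The value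
  \<open>0\<close> off the orbit space is needed because \<open>Metric_space\<close> requires symmetry and
  nonnegativity for all arguments.\<close>

definition quotient_dist ::
    "'a set \<Rightarrow> ('a \<Rightarrow> 'a \<Rightarrow> real) \<Rightarrow> ('a \<Rightarrow> 'a) set \<Rightarrow> 'a set \<Rightarrow> 'a set \<Rightarrow> real" where
  "quotient_dist M d \<Gamma> a b =
     (if a \<in> orbit_space M \<Gamma> \<and> b \<in> orbit_space M \<Gamma>
      then INF \<gamma>\<in>\<Gamma>. d (SOME x. x \<in> a) (\<gamma> (SOME y. y \<in> b)) else 0)"

text \<open>\<open>\<nu>\<close> is the Borel measure on the orbit space for which the orbit map preserves measure
  on each ball of radius a quarter of the systole; these balls are written out because this radius
  may be \<open>\<infinity>\<close>.\<close>

definition is_quotient_measure ::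
    "'a set \<Rightarrow> ('a \<Rightarrow> 'a \<Rightarrow> real) \<Rightarrow> 'a measure \<Rightarrow> ('a \<Rightarrow> 'a) set \<Rightarrow> 'a set measure \<Rightarrow> bool" where
  "is_quotient_measure M d \<mu> \<Gamma> \<nu> \<longleftrightarrow>
     sets \<nu> = sets (metric_borel (orbit_space M \<Gamma>) (quotient_dist M d \<Gamma>)) \<and>
     (\<forall>x\<in>M. let U = {z \<in> M. ereal (d x z) < systole M d \<Gamma> / 4} in
        \<forall>B\<in>sets \<nu>. B \<subseteq> orbit_map \<Gamma> ` U \<longrightarrow>
          emeasure \<nu> B = emeasure \<mu> {z \<in> U. orbit_map \<Gamma> z \<in> B})"

text \<open>Growth of the orbit of \<open>x\<close>; the set is finite for a proper action on a proper space.\<close>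

definition growth ::
    "'a set \<Rightarrow> ('a \<Rightarrow> 'a \<Rightarrow> real) \<Rightarrow> ('a \<Rightarrow> 'a) set \<Rightarrow> 'a \<Rightarrow> real \<Rightarrow> nat" where
  "growth M d \<Gamma> x R =
     card (orbit_map \<Gamma> x \<inter> (Metric_space.mtopology M d closure_of Metric_space.mball M d x R))"


subsection \<open>The quotient metric is well defined\<close>

lemma (in Metric_space) group_isometry_group: "group (isometry_group M d)"
proof -
  interpret B: group "BijGroup M"
    by (rule group_BijGroup)
  let ?I = "{f \<in> Bij M. \<forall>x\<in>M. \<forall>y\<in>M. d (f x) (f y) = d x y}"
  have "subgroup ?I (BijGroup M)"
  proof (rule B.subgroupI)
    show "?I \<subseteq> carrier (BijGroup M)"
      by (auto simp: BijGroup_def)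
    show "?I \<noteq> {}"
      using id_Bij by force
    show "f \<otimes>\<^bsub>BijGroup M\<^esub> g \<in> ?I" if "f \<in> ?I" "g \<in> ?I" for f g
      using that Bij_imp_funcset[of g M] by (auto simp: BijGroup_def compose_Bij compose_eq Pi_iff)
    show "inv\<^bsub>BijGroup M\<^esub> f \<in> ?I" if "f \<in> ?I" for f
    proof -
      have f: "f \<in> Bij M" "f ` M = M" "\<And>x y. x \<in> M \<Longrightarrow> y \<in> M \<Longrightarrow> d (f x) (f y) = d x y"
        using that by (auto simp: Bij_def bij_betw_def)
      have "d (inv_into M f x) (inv_into M f y) = d x y" if "x \<in> M" "y \<in> M" for x y
        using f(3)[of "inv_into M f x" "inv_into M f y"] f(2) that
        by (simp add: inv_into_into f_inv_into_f)
      then show ?thesis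
        using f(1) by (simp add: inv_BijGroup restrict_inv_into_Bij)
    qed
  qed
  then show ?thesis
    unfolding isometry_group_def by (rule B.subgroup_imp_group)
qed

context isometric_action
begin

lemma action_Bij: "\<gamma> \<in> \<Gamma> \<Longrightarrow> \<gamma> \<in> Bij M"
  using subgroup.subset[OF subgroup_isometries] by (auto simp: isometry_group_def)

lemma action_closed: "\<gamma> \<in> \<Gamma> \<Longrightarrow> x \<in> M \<Longrightarrow> \<gamma> x \<in> M"
  using action_Bij Bij_imp_funcset by blast

lemma action_isometry: "\<gamma> \<in> \<Gamma> \<Longrightarrow> x \<in> M \<Longrightarrow> y \<in> M \<Longrightarrow> d (\<gamma> x) (\<gamma> y) = d x y"
  using subgroup.subset[OF subgroup_isometries] by (auto simp: isometry_group_def)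

lemma action_one: "(\<lambda>x\<in>M. x) \<in> \<Gamma>"
  using subgroup.one_closed[OF subgroup_isometries] by (simp add: isometry_group_def BijGroup_def)

lemma action_compose: "\<gamma> \<in> \<Gamma> \<Longrightarrow> \<delta> \<in> \<Gamma> \<Longrightarrow> compose M \<gamma> \<delta> \<in> \<Gamma>"
  using subgroup.m_closed[OF subgroup_isometries, of \<gamma> \<delta>] action_Bij
  by (simp add: isometry_group_def BijGroup_def)

lemma action_inverse:
  assumes "\<gamma> \<in> \<Gamma>"
  obtains \<delta> where "\<delta> \<in> \<Gamma>" "\<And>x. x \<in> M \<Longrightarrow> \<delta> (\<gamma> x) = x" "\<And>x. x \<in> M \<Longrightarrow> \<gamma> (\<delta> x) = x"
proof
  let ?G = "isometry_group M d"
  interpret G: group ?G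
    by (rule group_isometry_group)
  have \<gamma>: "\<gamma> \<in> carrier ?G"
    using assms subgroup.subset[OF subgroup_isometries] by blast
  show inv: "inv\<^bsub>?G\<^esub> \<gamma> \<in> \<Gamma>"
    using subgroup.m_inv_closed[OF subgroup_isometries assms] .
  have l: "compose M (inv\<^bsub>?G\<^esub> \<gamma>) \<gamma> = (\<lambda>x\<in>M. x)" and r: "compose M \<gamma> (inv\<^bsub>?G\<^esub> \<gamma>) = (\<lambda>x\<in>M. x)"
    using G.l_inv[OF \<gamma>] G.r_inv[OF \<gamma>] action_Bij[OF assms] action_Bij[OF inv]
    by (simp_all add: isometry_group_def BijGroup_def)
  show "(inv\<^bsub>?G\<^esub> \<gamma>) (\<gamma> x) = x" if "x \<in> M" for x
    using fun_cong[OF l, of x] that by (simp add: compose_def)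
  show "\<gamma> ((inv\<^bsub>?G\<^esub> \<gamma>) x) = x" if "x \<in> M" for x
    using fun_cong[OF r, of x] that by (simp add: compose_def)
qed

lemma orbit_map_self: "x \<in> M \<Longrightarrow> x \<in> orbit_map \<Gamma> x"
  unfolding orbit_map_def by (rule image_eqI[OF _ action_one]) simp

lemma orbit_map_action:
  assumes "\<gamma> \<in> \<Gamma>" "x \<in> M"
  shows "orbit_map \<Gamma> (\<gamma> x) = orbit_map \<Gamma> x"
proof -
  obtain \<delta> where \<delta>: "\<delta> \<in> \<Gamma>" "\<And>x. x \<in> M \<Longrightarrow> \<delta> (\<gamma> x) = x"
    using action_inverse assms by metis
  have "\<epsilon> (\<gamma> x) \<in> orbit_map \<Gamma> x" if "\<epsilon> \<in> \<Gamma>" for \<epsilon>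
    unfolding orbit_map_def
    by (rule image_eqI[OF _ action_compose[OF that assms(1)]]) (simp add: compose_def assms(2))
  moreover have "\<epsilon> x \<in> orbit_map \<Gamma> (\<gamma> x)" if "\<epsilon> \<in> \<Gamma>" for \<epsilon>
  proof -
    have "compose M \<epsilon> \<delta> (\<gamma> x) = \<epsilon> x"
      using \<delta>(2) assms action_closed by (simp add: compose_def)
    then show ?thesis
      using action_compose[OF that \<delta>(1)] unfolding orbit_map_def by (metis image_eqI)
  qed
  ultimately show ?thesis
    unfolding orbit_map_def by blast
qed

lemma INF_action_eq: "(INF \<gamma>\<in>\<Gamma>. d x (\<gamma> y)) = Inf (d x ` orbit_map \<Gamma> y)"
  by (simp add: orbit_map_def image_image)

lemma INF_action_left:
  assumes "\<delta> \<in> \<Gamma>" "x \<in> M" "y \<in> M"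
  shows "Inf (d (\<delta> x) ` orbit_map \<Gamma> y) = Inf (d x ` orbit_map \<Gamma> y)"
proof -
  obtain \<epsilon> where \<epsilon>: "\<epsilon> \<in> \<Gamma>" "\<And>x. x \<in> M \<Longrightarrow> \<delta> (\<epsilon> x) = x"
    using action_inverse assms by metis
  have *: "d (\<delta> x) ` orbit_map \<Gamma> y \<subseteq> d x ` orbit_map \<Gamma> y"
    if "\<delta> \<in> \<Gamma>" "\<epsilon> \<in> \<Gamma>" "\<And>x. x \<in> M \<Longrightarrow> \<delta> (\<epsilon> x) = x" "x \<in> M" for \<delta> \<epsilon> x
  proof -
    have "d (\<delta> x) (\<gamma> y) = d x (compose M \<epsilon> \<gamma> y)" if "\<gamma> \<in> \<Gamma>" for \<gamma>
      using action_isometry[OF \<open>\<delta> \<in> \<Gamma>\<close> \<open>x \<in> M\<close>, of "\<epsilon> (\<gamma> y)"] that assms(3)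
        \<open>\<epsilon> \<in> \<Gamma>\<close> \<open>\<And>x. x \<in> M \<Longrightarrow> \<delta> (\<epsilon> x) = x\<close> action_closed by (simp add: compose_def)
    then show ?thesis
      using action_compose[OF \<open>\<epsilon> \<in> \<Gamma>\<close>] unfolding orbit_map_def by blast
  qed
  obtain \<eta> where \<eta>: "\<eta> \<in> \<Gamma>" "\<And>x. x \<in> M \<Longrightarrow> \<epsilon> (\<eta> x) = x"
    using action_inverse \<epsilon>(1) by metis
  have "\<epsilon> (\<delta> x) = x"
    using \<epsilon> \<eta> assms action_closed by metis
  then have "d x ` orbit_map \<Gamma> y \<subseteq> d (\<delta> x) ` orbit_map \<Gamma> y"
    using *[OF \<epsilon>(1) \<eta>(1) \<eta>(2), of "\<delta> x"] action_closed assms by simp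
  then show ?thesis
    using *[OF assms(1) \<epsilon> assms(2)] by (metis subset_antisym)
qed

lemma quotient_dist_orbit_map:
  assumes "x \<in> M" "y \<in> M"
  shows "quotient_dist M d \<Gamma> (orbit_map \<Gamma> x) (orbit_map \<Gamma> y) = (INF \<gamma>\<in>\<Gamma>. d x (\<gamma> y))"
proof -
  have "(SOME z. z \<in> orbit_map \<Gamma> x) \<in> orbit_map \<Gamma> x" "(SOME z. z \<in> orbit_map \<Gamma> y) \<in> orbit_map \<Gamma> y"
    using orbit_map_self assms by (metis someI)+
  then obtain \<alpha> \<beta> where "\<alpha> \<in> \<Gamma>" "(SOME z. z \<in> orbit_map \<Gamma> x) = \<alpha> x"
      and "\<beta> \<in> \<Gamma>" "(SOME z. z \<in> orbit_map \<Gamma> y) = \<beta> y"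
    by (auto simp: orbit_map_def)
  then show ?thesis
    using assms
    by (simp add: quotient_dist_def orbit_space_def INF_action_eq orbit_map_action INF_action_left)
qed

lemma INF_action_attained:
  assumes "x \<in> M" "y \<in> M"
  obtains \<gamma> where "\<gamma> \<in> \<Gamma>" "(INF \<gamma>\<in>\<Gamma>. d x (\<gamma> y)) = d x (\<gamma> y)"
proof -
  define K where "K = mcball x (d x y)"
  have y: "y \<in> K"
    using assms by (simp add: K_def)
  let ?F = "{\<gamma> \<in> \<Gamma>. d x (\<gamma> y) \<le> d x y}"
  have "?F \<subseteq> {\<gamma> \<in> \<Gamma>. \<gamma> ` K \<inter> K \<noteq> {}}"
    using y assms action_closed by (fastforce simp: K_def)
  then have fin: "finite ?F"
    using proper_action[OF proper[OF assms(1), of "d x y"]] finite_subset unfolding K_def by blast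
  have ne: "?F \<noteq> {}"
    using action_one assms by force
  obtain \<gamma> where \<gamma>: "\<gamma> \<in> ?F" "\<And>\<delta>. \<delta> \<in> ?F \<Longrightarrow> d x (\<gamma> y) \<le> d x (\<delta> y)"
    using ex_min_if_finite[of "(\<lambda>\<gamma>. d x (\<gamma> y)) ` ?F"] fin ne
    by (smt (verit, ccfv_SIG) arg_min_if_finite(1) arg_min_least)
  have "d x (\<gamma> y) \<le> d x (\<delta> y)" if "\<delta> \<in> \<Gamma>" for \<delta>
    using \<gamma> that by (cases "\<delta> \<in> ?F") auto
  then have "(INF \<gamma>\<in>\<Gamma>. d x (\<gamma> y)) = d x (\<gamma> y)"
    using \<gamma>(1) by (intro cInf_eq_minimum) auto
  then show ?thesis
    using that \<gamma>(1) by blast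
qed

lemma INF_action_le: "\<gamma> \<in> \<Gamma> \<Longrightarrow> (INF \<gamma>\<in>\<Gamma>. d x (\<gamma> y)) \<le> d x (\<gamma> y)"
  by (rule cINF_lower) (auto intro: bdd_belowI2[where m = 0])

lemma Metric_space_quotient: "Metric_space (orbit_space M \<Gamma>) (quotient_dist M d \<Gamma>)"
proof
  let ?p = "orbit_map \<Gamma>" and ?q = "quotient_dist M d \<Gamma>"
  have ne: "\<Gamma> \<noteq> {}"
    using action_one by blast
  have le: "?q (?p x) (?p y) \<le> d x (\<gamma> y)" if "x \<in> M" "y \<in> M" "\<gamma> \<in> \<Gamma>" for x y \<gamma>
    using that by (simp add: quotient_dist_orbit_map INF_action_le)
  have ex: "\<exists>\<gamma>\<in>\<Gamma>. ?q (?p x) (?p y) = d x (\<gamma> y)" if "x \<in> M" "y \<in> M" for x y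
    using INF_action_attained[OF that] that by (metis quotient_dist_orbit_map)
  show "0 \<le> ?q a b" for a b
    by (auto simp: quotient_dist_def ne intro!: cINF_greatest)
  have sym_le: "?q (?p y) (?p x) \<le> ?q (?p x) (?p y)" if xy: "x \<in> M" "y \<in> M" for x y
  proof -
    obtain \<gamma> where \<gamma>: "\<gamma> \<in> \<Gamma>" "?q (?p x) (?p y) = d x (\<gamma> y)"
      using ex xy by blast
    then show ?thesis
      using le[of "\<gamma> y" x "\<lambda>x\<in>M. x"] xy action_one action_closed
      by (simp add: orbit_map_action commute)
  qed
  show "?q a b = ?q b a" for a b
  proof (cases "a \<in> orbit_space M \<Gamma> \<and> b \<in> orbit_space M \<Gamma>")
    case True
    then show ?thesis
      using sym_le by (auto simp: orbit_space_def intro: antisym)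
  qed (auto simp: quotient_dist_def)
  show "(?q a b = 0) = (a = b)" if ab: "a \<in> orbit_space M \<Gamma>" "b \<in> orbit_space M \<Gamma>" for a b
  proof -
    obtain x y where xy: "x \<in> M" "y \<in> M" "a = ?p x" "b = ?p y"
      using ab unfolding orbit_space_def by blast
    have "a = b" if "?q a b = 0"
      using ex[OF xy(1,2)] that xy action_closed orbit_map_action by (metis zero)
    moreover have "?q a a = 0"
      using le[OF xy(1,1) action_one] \<open>0 \<le> ?q a a\<close> xy by simp
    ultimately show ?thesis
      by blast
  qed
  show "?q a c \<le> ?q a b + ?q b c"
    if abc: "a \<in> orbit_space M \<Gamma>" "b \<in> orbit_space M \<Gamma>" "c \<in> orbit_space M \<Gamma>" for a b c
  proof -
    obtain x y z where xyz: "x \<in> M" "y \<in> M" "z \<in> M" "a = ?p x" "b = ?p y" "c = ?p z"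
      using abc unfolding orbit_space_def by blast
    obtain \<gamma> where \<gamma>: "\<gamma> \<in> \<Gamma>" "?q a b = d x (\<gamma> y)"
      using ex xyz by blast
    obtain \<delta> where \<delta>: "\<delta> \<in> \<Gamma>" "?q b c = d (\<gamma> y) (\<delta> z)"
      using ex[of "\<gamma> y" z] xyz \<gamma> action_closed orbit_map_action by metis
    show ?thesis
      using le[OF xyz(1,3) \<delta>(1)] triangle[of x "\<gamma> y" "\<delta> z"] \<gamma> \<delta> xyz action_closed by simp
  qed
qed

end

end

theory Submission
  imports Defs
begin

text \<open>
  Since the systole is at least \<open>4\<close>, the orbit map is isometric on closed unit balls, so the
  Poincare inequality of the orbit space at radius \<open>1\<close> lifts to every unit ball of \<open>X\<close>. Unit balls
  whose centres are at distance at most \<open>1\<close> share a ball of radius \<open>1/2\<close>, of volume at least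
  \<open>1\<close>; hence, along a geodesic from \<open>x\<close> of length less than \<open>R\<close>, the local averages change by an
  amount controlled by the energy in \<open>B(x, R + 1)\<close>, each point of which lies in at most three of
  the unit balls used. Finally \<open>B(x, R)\<close> is covered by the unit balls around a maximal
  \<open>1\<close>-separated set, which has at most \<open>V\<^sub>0 F(2\<lambda>R)\<close> elements. The numerical constants leave enough room
  as soon as \<open>D \<ge> 1\<close>, which holds unless \<open>B(x, R) = B(x, 1)\<close>.
\<close>

section \<open>Powers and averages\<close>

text \<open>The obstacle is that \<open>u\<close> is not invariant, so it does not descend to the
  orbit space, where the hypothesis concerns globally continuous functions with global upper
  gradients. It descends only over a closed unit ball, on which the orbit map can be inverted. A
  Tietze extension makes it global but is uncontrolled outside; giving the gradient the value
  \<infinity> there repairs this at no cost, since both integrals of the Poincare inequality only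
  see the open unit ball. Averages are the second difficulty: those over balls of the orbit space,
  unit balls and the large ball would have to be compared. So a unit ball only carries some constant
  \<open>c p\<close>, and the average over \<open>B(x, R)\<close> enters once, at the end, for a
  factor \<open>2 powr s\<close>. The factor \<open>R powr (s - 1)\<close> is the price of the power
  mean inequality on a chain of about \<open>R\<close> steps. Two factors \<open>V\<close> arise,
  one from counting the net and one from the volume of a unit ball; the second is absorbed by
  \<open>lam ^ 4\<close>.\<close>

lemma powr_above_tangent:
  fixes s m t :: real
  assumes "1 \<le> s" "0 \<le> m" "0 \<le> t"
  shows "m powr s + s * m powr (s - 1) * (t - m) \<le> t powr s"
proof -
  \<comment> \<open>Convexity is used at positive points only. For \<open>m = 0\<close> the left
    side vanishes, also when \<open>s = 1\<close>, because \<open>0 powr 0 = 0\<close>.\<close>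
  consider "m = 0" | "0 < m" "t = 0" | "0 < m" "0 < t"
    using assms by linarith
  then show ?thesis
  proof cases
    case 2
    have "s * m powr (s - 1) * m = s * m powr s"
      using 2 by (simp add: powr_diff)
    moreover have "m powr s \<le> s * m powr s"
      using assms(1) mult_right_mono[of 1 s "m powr s"] by simp
    ultimately show ?thesis
      using 2 by (simp add: algebra_simps)
  next
    case 3
    have "(s * m powr (s - 1)) * (t - m) \<le> t powr s - m powr s"
      by (rule convex_on_imp_above_tangent[OF powr_convex[OF assms(1)]])
        (use 3 in \<open>auto intro!: derivative_eq_intros simp: interior_open\<close>)
    then show ?thesis by simp
  qed simp
qed

text \<open>The power mean inequality: tangents at the mean of the \<open>t i\<close> are added up,
  and their linear parts cancel. The same argument with an integral gives Jensen's inequality in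
  \<open>ball_average_powr_le\<close>.\<close>

lemma sum_powr_le:
  fixes t :: "'i \<Rightarrow> real"
  assumes s: "1 \<le> s" and t: "\<And>i. i \<in> I \<Longrightarrow> 0 \<le> t i"
  shows "(\<Sum>i\<in>I. t i) powr s \<le> real (card I) powr (s - 1) * (\<Sum>i\<in>I. t i powr s)"
proof (cases "finite I \<and> I \<noteq> {}")
  case True
  define n where "n = real (card I)"
  define m where "m = (\<Sum>i\<in>I. t i) / n"
  have n: "0 < n"
    using True by (simp add: n_def card_gt_0_iff)
  have m: "0 \<le> m" "(\<Sum>i\<in>I. t i) = n * m"
    using n t by (auto simp: m_def sum_nonneg)
  have "n * m powr s = (\<Sum>i\<in>I. m powr s + s * m powr (s - 1) * (t i - m))"
    using m(2) by (simp add: sum.distrib sum_subtractf flip: sum_distrib_left n_def)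
  also have "\<dots> \<le> (\<Sum>i\<in>I. t i powr s)"
    by (intro sum_mono powr_above_tangent s m t)
  finally have "n powr (s - 1) * (n * m powr s) \<le> n powr (s - 1) * (\<Sum>i\<in>I. t i powr s)"
    by (intro mult_left_mono) auto
  moreover have "(n * m) powr s = n powr (s - 1) * (n * m powr s)"
    using n m by (simp add: powr_mult powr_diff)
  ultimately show ?thesis
    using m(2) by (simp add: n_def)
qed (use s in auto)

lemma abs_add_powr_le:
  fixes a b :: real
  assumes "1 \<le> s"
  shows "\<bar>a + b\<bar> powr s \<le> 2 powr (s - 1) * (\<bar>a\<bar> powr s + \<bar>b\<bar> powr s)"
proof -
  have "\<bar>a + b\<bar> powr s \<le> (\<bar>a\<bar> + \<bar>b\<bar>) powr s"
    using assms by (intro powr_mono2) auto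
  also have "\<dots> = (\<Sum>i\<in>{0, 1::nat}. if i = 0 then \<bar>a\<bar> else \<bar>b\<bar>) powr s"
    by simp
  also have "\<dots> \<le> real (card {0, 1::nat}) powr (s - 1) *
      (\<Sum>i\<in>{0, 1::nat}. (if i = 0 then \<bar>a\<bar> else \<bar>b\<bar>) powr s)"
    by (intro sum_powr_le assms) auto
  finally show ?thesis by simp
qed

lemma ennreal_powr_measurable:
  assumes [measurable]: "f \<in> borel_measurable N"
  shows "(\<lambda>z. ennreal_powr (f z) s) \<in> borel_measurable N"
  unfolding ennreal_powr_def by measurable

section \<open>Borel sets and continuous maps\<close>

context Metric_space
begin

lemma space_metric_borel: "space (metric_borel M d) = M"
  by (metis metric_borel_def openin_subset space_measure_of_conv topspace_mtopology)

lemma openin_metric_borel: "openin mtopology U \<Longrightarrow> U \<in> sets (metric_borel M d)"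
  unfolding metric_borel_def
  by (subst sets_measure_of) (use openin_subset in fastforce)+

lemma continuous_map_metric_borel:
  assumes f: "continuous_map mtopology (Metric_space.mtopology M' d') f" and "Metric_space M' d'"
  shows "f \<in> metric_borel M d \<rightarrow>\<^sub>M metric_borel M' d'"
proof -
  interpret M': Metric_space M' d' by fact
  show ?thesis
    unfolding metric_borel_def[of M']
  proof (rule measurable_measure_of)
    show "{U. openin M'.mtopology U} \<subseteq> Pow M'"
      using openin_subset by fastforce
    show "f \<in> space (metric_borel M d) \<rightarrow> M'"
      using continuous_map_image_subset_topspace[OF f] by (auto simp: space_metric_borel)
    show "f -` U \<inter> space (metric_borel M d) \<in> sets (metric_borel M d)"
      if "U \<in> {U. openin M'.mtopology U}" for U
    proof -
      have "f -` U \<inter> space (metric_borel M d) = {z \<in> topspace mtopology. f z \<in> U}"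
        by (auto simp: space_metric_borel)
      then show ?thesis
        using openin_continuous_map_preimage[OF f, of U] that openin_metric_borel by simp
    qed
  qed
qed

lemma continuous_map_real_metric_borel:
  assumes "continuous_map mtopology euclideanreal u"
  shows "u \<in> borel_measurable (metric_borel M d)"
proof (rule borel_measurableI)
  fix S :: "real set"
  assume "open S"
  then have "openin mtopology {x \<in> topspace mtopology. u x \<in> S}"
    using openin_continuous_map_preimage[OF assms] by simp
  moreover have "u -` S \<inter> space (metric_borel M d) = {x \<in> topspace mtopology. u x \<in> S}"
    by (auto simp: space_metric_borel)
  ultimately show "u -` S \<inter> space (metric_borel M d) \<in> sets (metric_borel M d)"
    using openin_metric_borel by simp
qed

end

context measured_metric_space
begin

lemma space_eq: "space \<mu> = M"
  using sets_eq_imp_space_eq[OF borel_sets] space_metric_borel by simp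

lemma openin_sets: "openin mtopology U \<Longrightarrow> U \<in> sets \<mu>"
  using openin_metric_borel borel_sets by simp

lemma mball_sets [measurable]: "mball x r \<in> sets \<mu>"
  by (intro openin_sets) simp

lemma continuous_map_borel:
  "continuous_map mtopology euclideanreal u \<Longrightarrow> u \<in> borel_measurable \<mu>"
  using continuous_map_real_metric_borel measurable_cong_sets[OF borel_sets refl] by blast

lemma mball_finite: "emeasure \<mu> (mball x r) < \<infinity>"
proof (cases "x \<in> M \<and> 0 < r")
  case True
  have "mcball x r \<in> sets \<mu>"
  proof -
    have "M - (M - mcball x r) = mcball x r"
      by auto
    then show ?thesis
      using sets.compl_sets[OF openin_sets, of "M - mcball x r"] closedin_mcball[of x r]
      by (auto simp: closedin_def space_eq)
  qed
  then have "emeasure \<mu> (mball x r) \<le> emeasure \<mu> (mcball x r)"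
    by (intro emeasure_mono mball_subset_mcball)
  then show ?thesis
    using mcball_measure[of x r] True by (simp add: order_le_less_trans)
next
  case False
  then have "mball x r = {}" by (auto simp: in_mball) (use nonneg order.strict_trans1 in blast)
  then show ?thesis by simp
qed

text \<open>The average \<open>w\<close> differs from \<open>a\<close> by at most the mean
  \<open>m\<close> of \<open>\<bar>u - a\<bar>\<close>, and by Jensen the volume times
  \<open>m powr s\<close> is at most the integral on the right. Splitting \<open>u - w\<close> at
  \<open>a\<close> therefore yields twice that integral with the factor
  \<open>2 powr (s - 1)\<close>.\<close>

lemma ball_average_powr_le:
  assumes u: "continuous_map mtopology euclideanreal u" and x: "x \<in> M" and s: "1 \<le> s"
    and pos: "0 < emeasure \<mu> (mball x R)"
  shows "(\<integral>\<^sup>+z\<in>mball x R. ennreal (\<bar>u z - ball_average M d \<mu> u R x\<bar> powr s) \<partial>\<mu>)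
    \<le> ennreal (2 powr s) * (\<integral>\<^sup>+z\<in>mball x R. ennreal (\<bar>u z - a\<bar> powr s) \<partial>\<mu>)"
proof -
  define B where "B = mball x R"
  define N where "N = restrict_space \<mu> B"
  define V where "V = measure \<mu> B"
  define w where "w = ball_average M d \<mu> u R x"
  have [measurable]: "B \<in> sets \<mu>"
    by (simp add: B_def)
  have um [measurable]: "u \<in> borel_measurable \<mu>"
    by (rule continuous_map_borel[OF u])
  have BN: "B \<inter> space \<mu> \<in> sets \<mu>" by auto
  have spN: "space N = B"
    using sets.sets_into_space[of B \<mu>] by (auto simp: N_def space_restrict_space)
  have emN: "emeasure N B = emeasure \<mu> B"
    using BN by (simp add: N_def emeasure_restrict_space)
  have emV: "emeasure \<mu> B = ennreal V"
    using mball_finite[of x R] by (simp add: V_def B_def emeasure_eq_ennreal_measure)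
  have V: "0 < V"
    using pos emV by (simp add: B_def)
  have mN: "measure N B = V"
    using emN by (simp add: V_def measure_def)
  interpret N: finite_measure N
    using emN emV spN by (intro finite_measureI) simp
  \<comment> \<open>Boundedness of \<open>u\<close> on the compact closed ball provides
    integrability; otherwise the Bochner integral, and with it the average, would default to
    0.\<close>
  have "compactin euclideanreal (u ` mcball x R)"
    using image_compactin[OF proper[OF x] u] .
  then have "bounded (u ` mcball x R)"
    by (simp add: compact_imp_bounded)
  then obtain b where b: "\<And>z. z \<in> mcball x R \<Longrightarrow> \<bar>u z\<bar> \<le> b"
    unfolding bounded_iff by (metis imageI real_norm_def)
  have b': "\<bar>u z\<bar> \<le> b" if "z \<in> B" for z
    using b mball_subset_mcball that unfolding B_def by blast
  have [measurable]: "u \<in> borel_measurable N"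
    using um unfolding N_def by (rule measurable_restrict_space1)
  have iu: "integrable N u"
    by (rule N.integrable_const_bound[where B = b]) (use b' spN in \<open>auto intro!: AE_I2\<close>)
  have ip: "integrable N (\<lambda>z. \<bar>u z - a\<bar> powr s)" for a
    using s b' spN
    by (intro N.integrable_const_bound[where B = "(b + \<bar>a\<bar>) powr s"] AE_I2)
      (fastforce intro!: powr_mono2)+
  define f where "f = (\<lambda>z. \<bar>u z - a\<bar>)"
  define m where "m = (\<integral>z. f z \<partial>N) / V"
  have if': "integrable N f"
    using iu by (auto simp: f_def)
  have int_f: "(\<integral>z. f z \<partial>N) = V * m"
    using V by (simp add: m_def)
  have m0: "0 \<le> m"
    using V by (auto simp: m_def f_def)
  have w_eq: "w = (\<integral>z. u z \<partial>N) / V"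
    using BN by (simp add: w_def ball_average_def V_def B_def N_def set_lebesgue_integral_def integral_restrict_space)
  have "w - a = (\<integral>z. u z - a \<partial>N) / V"
    using iu V w_eq mN spN by (simp add: field_simps)
  then have wa: "\<bar>w - a\<bar> \<le> m"
    using V integral_abs_bound[of N "\<lambda>z. u z - a"] by (simp add: m_def f_def divide_right_mono abs_div)
  \<comment> \<open>The term linear in \<open>f z - m\<close> integrates to 0 by the choice of
    \<open>m\<close>.\<close>
  have "V * m powr s = (\<integral>z. m powr s + s * m powr (s - 1) * (f z - m) \<partial>N)"
    using if' int_f spN mN by (simp add: algebra_simps)
  also have "\<dots> \<le> (\<integral>z. f z powr s \<partial>N)"
    using ip[of a] if' s m0 by (intro integral_mono powr_above_tangent) (auto simp: f_def)
  finally have jensen: "V * m powr s \<le> (\<integral>z. f z powr s \<partial>N)" .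
  have "(\<integral>z. \<bar>u z - w\<bar> powr s \<partial>N) \<le> (\<integral>z. 2 powr (s - 1) * (f z powr s + m powr s) \<partial>N)"
  proof (rule integral_mono)
    show "integrable N (\<lambda>z. 2 powr (s - 1) * (f z powr s + m powr s))"
      using ip[of a] by (auto simp: f_def)
    show "\<bar>u z - w\<bar> powr s \<le> 2 powr (s - 1) * (f z powr s + m powr s)" for z
    proof -
      have "\<bar>u z - w\<bar> powr s = \<bar>(u z - a) + (a - w)\<bar> powr s" by simp
      also have "\<dots> \<le> 2 powr (s - 1) * (\<bar>u z - a\<bar> powr s + \<bar>a - w\<bar> powr s)"
        by (rule abs_add_powr_le[OF s])
      also have "\<dots> \<le> 2 powr (s - 1) * (f z powr s + m powr s)"
        unfolding f_def using wa s by (intro mult_left_mono add_mono powr_mono2) auto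
      finally show ?thesis .
    qed
  qed (rule ip)
  also have "\<dots> = 2 powr (s - 1) * ((\<integral>z. f z powr s \<partial>N) + V * m powr s)"
    using ip[of a] spN mN by (simp add: f_def)
  also have "\<dots> \<le> 2 powr (s - 1) * (2 * (\<integral>z. f z powr s \<partial>N))"
    using jensen by (intro mult_left_mono) auto
  also have "\<dots> = 2 powr s * (\<integral>z. f z powr s \<partial>N)"
    by (simp add: powr_diff)
  finally have main: "(\<integral>z. \<bar>u z - w\<bar> powr s \<partial>N) \<le> 2 powr s * (\<integral>z. \<bar>u z - a\<bar> powr s \<partial>N)"
    by (simp add: f_def)
  have nn: "(\<integral>\<^sup>+z\<in>mball x R. ennreal (\<bar>u z - a\<bar> powr s) \<partial>\<mu>) = ennreal (\<integral>z. \<bar>u z - a\<bar> powr s \<partial>N)" for a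
  proof -
    have "(\<integral>\<^sup>+z\<in>mball x R. ennreal (\<bar>u z - a\<bar> powr s) \<partial>\<mu>) = (\<integral>\<^sup>+z. ennreal (\<bar>u z - a\<bar> powr s) \<partial>N)"
      using BN by (simp add: N_def nn_integral_restrict_space B_def)
    then show ?thesis
      using nn_integral_eq_integral[OF ip[of a]] by simp
  qed
  show ?thesis
    unfolding nn using main by (simp add: w_def flip: ennreal_mult')
qed

end

section \<open>Chains of unit balls\<close>

text \<open>Exchanging sum and integral leaves at each point the number of sets \<open>A i\<close>
  through it. This serves twice: for the unit balls along a geodesic, with \<open>k = 3\<close>, and
  with \<open>h = 1\<close> on the orbit space, to bound the size of a separated set.\<close>

lemma nn_integral_sum_indicator_le:
  fixes h :: "'b \<Rightarrow> ennreal" and k :: real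
  assumes h: "h \<in> borel_measurable N" and A: "\<And>i. i \<in> I \<Longrightarrow> A i \<in> sets N"
    and I: "finite I"
    and le: "\<And>z. z \<in> space N \<Longrightarrow> real (card {i\<in>I. z \<in> A i}) \<le> k"
    and sub: "\<And>i. i \<in> I \<Longrightarrow> A i \<subseteq> B" and B: "B \<in> sets N"
  shows "(\<Sum>i\<in>I. \<integral>\<^sup>+z\<in>A i. h z \<partial>N) \<le> ennreal k * (\<integral>\<^sup>+z\<in>B. h z \<partial>N)"
proof -
  have "(\<Sum>i\<in>I. \<integral>\<^sup>+z\<in>A i. h z \<partial>N) = (\<integral>\<^sup>+z. (\<Sum>i\<in>I. h z * indicator (A i) z) \<partial>N)"
    using h A by (subst nn_integral_sum) (auto intro!: borel_measurable_times)
  also have "\<dots> \<le> (\<integral>\<^sup>+z. ennreal k * (h z * indicator B z) \<partial>N)"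
  proof (rule nn_integral_mono)
    fix z
    assume z: "z \<in> space N"
    have "(\<Sum>i\<in>I. h z * indicator (A i) z) = h z * (\<Sum>i\<in>I. indicator (A i) z)"
      by (simp add: sum_distrib_left)
    also have "(\<Sum>i\<in>I. indicator (A i) z) = (of_nat (card {i\<in>I. z \<in> A i}) :: ennreal)"
      using I by (simp add: indicator_def sum.If_cases Int_def)
    also have "h z * of_nat (card {i\<in>I. z \<in> A i}) \<le> ennreal k * (h z * indicator B z)"
    proof (cases "{i\<in>I. z \<in> A i} = {}")
      case True
      then show ?thesis by (simp only: card.empty) simp
    next
      case False
      then have "z \<in> B"
        using sub by blast
      moreover have "of_nat (card {i\<in>I. z \<in> A i}) \<le> ennreal k"
        using le[OF z] by (simp add: ennreal_of_nat_eq_real_of_nat ennreal_leI)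
      ultimately show ?thesis
        by (simp add: mult.commute[of "ennreal k"] mult_left_mono)
    qed
    finally show "(\<Sum>i\<in>I. h z * indicator (A i) z) \<le> ennreal k * (h z * indicator B z)" .
  qed
  also have "\<dots> = ennreal k * (\<integral>\<^sup>+z\<in>B. h z \<partial>N)"
    using h B by (intro nn_integral_cmult borel_measurable_times) auto
  finally show ?thesis .
qed

text \<open>The constants \<open>c p\<close> need not be averages: any constants satisfying the local inequality
  can be compared along chains of overlapping balls.\<close>

locale local_poincare = measured_metric_space M d \<mu>
  for M :: "'a set" and d :: "'a \<Rightarrow> 'a \<Rightarrow> real" and \<mu> :: "'a measure" +
  fixes u :: "'a \<Rightarrow> real" and h :: "'a \<Rightarrow> ennreal" and c :: "'a \<Rightarrow> real" and K :: ennreal and s :: real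
  assumes s: "1 \<le> s"
    and u_borel [measurable]: "u \<in> borel_measurable \<mu>"
    and h_borel [measurable]: "h \<in> borel_measurable \<mu>"
    and half_ball: "\<And>p. p \<in> M \<Longrightarrow> 1 \<le> emeasure \<mu> (mball p (1 / 2))"
    and poincare: "\<And>p. p \<in> M \<Longrightarrow>
      (\<integral>\<^sup>+z\<in>mball p 1. ennreal (\<bar>u z - c p\<bar> powr s) \<partial>\<mu>) \<le> K * (\<integral>\<^sup>+z\<in>mball p 1. h z \<partial>\<mu>)"
begin

definition energy :: "'a \<Rightarrow> ennreal" where
  "energy p = (\<integral>\<^sup>+z\<in>mball p 1. h z \<partial>\<mu>)"

text \<open>A nonnegative constant is at most its own integral over a set of volume at least 1. On
  the half ball around \<open>m\<close> both local inequalities are available, and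
  \<open>c p - c q\<close> is split at \<open>u z\<close>.\<close>

lemma adjacent_centres:
  assumes M: "p \<in> M" "q \<in> M" "m \<in> M" and pm: "d p m \<le> 1 / 2" and qm: "d q m \<le> 1 / 2"
  shows "ennreal (\<bar>c p - c q\<bar> powr s) \<le> ennreal (2 powr (s - 1)) * K * (energy p + energy q)"
proof -
  let ?B = "mball m (1 / 2)"
  let ?e = "ennreal (2 powr (s - 1))"
  have sub: "?B \<subseteq> mball p 1" "?B \<subseteq> mball q 1"
    using M pm qm triangle[of p m] triangle[of q m] by fastforce+
  have "ennreal (\<bar>c p - c q\<bar> powr s) \<le> ennreal (\<bar>c p - c q\<bar> powr s) * emeasure \<mu> ?B"
    using mult_left_mono[OF half_ball[OF M(3)], of "ennreal (\<bar>c p - c q\<bar> powr s)"] by simp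
  also have "\<dots> = (\<integral>\<^sup>+z\<in>?B. ennreal (\<bar>c p - c q\<bar> powr s) \<partial>\<mu>)"
    by (simp add: nn_integral_cmult_indicator)
  also have "\<dots> \<le> (\<integral>\<^sup>+z. ?e * (ennreal (\<bar>u z - c p\<bar> powr s) * indicator (mball p 1) z
      + ennreal (\<bar>u z - c q\<bar> powr s) * indicator (mball q 1) z) \<partial>\<mu>)"
  proof (rule nn_integral_mono)
    fix z
    have "\<bar>c p - c q\<bar> powr s = \<bar>(c p - u z) + (u z - c q)\<bar> powr s" by simp
    also have "\<dots> \<le> 2 powr (s - 1) * (\<bar>c p - u z\<bar> powr s + \<bar>u z - c q\<bar> powr s)"
      by (rule abs_add_powr_le[OF s])
    finally have "ennreal (\<bar>c p - c q\<bar> powr s)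
        \<le> ?e * (ennreal (\<bar>u z - c p\<bar> powr s) + ennreal (\<bar>u z - c q\<bar> powr s))"
      by (simp add: abs_minus_commute ennreal_leI flip: ennreal_mult' ennreal_plus)
    then show "ennreal (\<bar>c p - c q\<bar> powr s) * indicator ?B z
        \<le> ?e * (ennreal (\<bar>u z - c p\<bar> powr s) * indicator (mball p 1) z
          + ennreal (\<bar>u z - c q\<bar> powr s) * indicator (mball q 1) z)"
      using sub by (cases "z \<in> ?B") (auto simp: subset_iff simp del: in_mball)
  qed
  also have "\<dots> = ?e * ((\<integral>\<^sup>+z\<in>mball p 1. ennreal (\<bar>u z - c p\<bar> powr s) \<partial>\<mu>)
      + (\<integral>\<^sup>+z\<in>mball q 1. ennreal (\<bar>u z - c q\<bar> powr s) \<partial>\<mu>))"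
    by (simp add: nn_integral_cmult nn_integral_add)
  also have "\<dots> \<le> ?e * (K * energy p + K * energy q)"
    unfolding energy_def by (intro mult_left_mono add_mono poincare M) simp
  finally show ?thesis
    by (simp add: distrib_left mult.assoc)
qed

text \<open>In the constant, 6 is twice the multiplicity 3, as an inner centre is charged by the
  step before it and the step after it. The power collects \<open>2 powr (s - 1)\<close> from each
  step and the power mean factor of \<open>n + 1\<close> steps: \<open>2 * (n + 1)\<close> is at
  most \<open>2 * R + 2\<close>, which is at most \<open>5 / 2 * R\<close> for
  \<open>R \<ge> 4\<close>.\<close>

lemma distant_centres:
  assumes xy: "x \<in> M" "y \<in> M" and dR: "d x y < R" and R: "4 \<le> R"
  shows "ennreal (\<bar>c x - c y\<bar> powr s)
    \<le> ennreal (6 * (5 / 2 * R) powr (s - 1)) * K * (\<integral>\<^sup>+z\<in>mball x (R + 1). h z \<partial>\<mu>)"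
proof -
  obtain e where e: "e \<in> {0..d x y} \<rightarrow> M" "e 0 = x" "e (d x y) = y"
      "\<And>a b. a \<in> {0..d x y} \<Longrightarrow> b \<in> {0..d x y} \<Longrightarrow> d (e a) (e b) = \<bar>a - b\<bar>"
    using geodesic[OF xy] by blast
  define n where "n = nat \<lfloor>d x y\<rfloor>"
  \<comment> \<open>The points \<open>P k\<close> have unit spacing; \<open>min\<close> shortens the
    last step so that it ends exactly at \<open>y\<close>.\<close>
  define \<tau> where "\<tau> k = min (real k) (d x y)" for k
  define P where "P k = e (\<tau> k)" for k
  have n: "real n \<le> d x y" "d x y < real n + 1"
    using of_nat_floor[of "d x y"] by (simp_all add: n_def)
  have \<tau>: "\<tau> k \<in> {0..d x y}" for k
    by (simp add: \<tau>_def)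
  have P: "P k \<in> M" for k
    using e(1) \<tau> by (auto simp: P_def)
  have P0: "P 0 = x" "P (Suc n) = y"
    using e(2,3) n by (auto simp: P_def \<tau>_def min_def)
  have step: "ennreal (\<bar>c (P k) - c (P (Suc k))\<bar> powr s)
      \<le> ennreal (2 powr (s - 1)) * K * (energy (P k) + energy (P (Suc k)))" for k
  proof -
    \<comment> \<open>Halfway between two consecutive points lies the centre of the shared half
      ball.\<close>
    let ?t = "(\<tau> k + \<tau> (Suc k)) / 2"
    have t: "?t \<in> {0..d x y}"
      using \<tau>[of k] \<tau>[of "Suc k"] by auto
    have "\<tau> k \<le> \<tau> (Suc k)" "\<tau> (Suc k) \<le> \<tau> k + 1"
      by (auto simp: \<tau>_def)
    then have "\<bar>\<tau> k - ?t\<bar> \<le> 1 / 2" "\<bar>\<tau> (Suc k) - ?t\<bar> \<le> 1 / 2"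
      by (simp_all add: abs_le_iff field_simps)
    then have "d (P k) (e ?t) \<le> 1 / 2" "d (P (Suc k)) (e ?t) \<le> 1 / 2"
      using e(4)[OF \<tau>[of k] t] e(4)[OF \<tau>[of "Suc k"] t] by (simp_all only: P_def)
    moreover have "e ?t \<in> M"
      using e(1) t by blast
    ultimately show ?thesis
      using P by (intro adjacent_centres)
  qed
  \<comment> \<open>The centres of unit balls through \<open>z\<close> are less than 2 apart, and
    \<open>P 0\<close> to \<open>P n\<close> sit at integer parameters, so at most two consecutive
    ones qualify. The end point \<open>P (Suc n)\<close> need not fit this pattern and is counted
    separately.\<close>
  have card: "real (card {k\<in>{..Suc n}. z \<in> mball (P k) 1}) \<le> 3" for z
  proof -
    let ?A = "{k\<in>{..n}. z \<in> mball (P k) 1}"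
    have "card ?A \<le> 2"
    proof (cases "?A = {}")
      case False
      define j where "j = Min ?A"
      have j: "j \<in> ?A" "\<And>k. k \<in> ?A \<Longrightarrow> j \<le> k"
        using Min_in[OF _ False] by (auto simp: j_def)
      have "?A \<subseteq> {j, Suc j}"
      proof
        fix k
        assume k: "k \<in> ?A"
        have "d (P j) (P k) < 2"
          using triangle[of "P j" z "P k"] j(1) k P by (auto simp: commute)
        moreover have "d (P j) (P k) = \<bar>real j - real k\<bar>"
          using e(4)[OF \<tau>[of j] \<tau>[of k]] n j(1) k by (auto simp: P_def \<tau>_def min_def)
        ultimately show "k \<in> {j, Suc j}"
          using j(2)[OF k] by auto
      qed
      then have "card ?A \<le> card {j, Suc j}"
        by (intro card_mono) auto
      then show ?thesis by simp
    qed (simp only: card.empty)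
    moreover have "card {k\<in>{..Suc n}. z \<in> mball (P k) 1} \<le> card (insert (Suc n) ?A)"
      by (intro card_mono) (auto simp: le_Suc_eq)
    moreover have "card (insert (Suc n) ?A) \<le> Suc (card ?A)"
      by (rule card_insert_le_m1[THEN order_trans]) auto
    ultimately show ?thesis by simp
  qed
  have sub: "mball (P k) 1 \<subseteq> mball x (R + 1)" for k
  proof -
    have "d x (P k) \<le> d x y"
      using e(4)[of 0 "\<tau> k"] e(2) \<tau>[of k] by (simp add: P_def)
    then show ?thesis
      using triangle[of x "P k"] xy P dR by fastforce
  qed
  let ?G = "\<integral>\<^sup>+z\<in>mball x (R + 1). h z \<partial>\<mu>"
  have sum3: "(\<Sum>k\<le>Suc n. energy (P k)) \<le> ennreal 3 * ?G"
    unfolding energy_def by (intro nn_integral_sum_indicator_le card sub) auto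
  have "\<bar>c x - c y\<bar> = \<bar>\<Sum>k<Suc n. c (P (Suc k)) - c (P k)\<bar>"
    by (subst sum_lessThan_telescope) (simp add: P0 abs_minus_commute)
  also have "\<dots> \<le> (\<Sum>k<Suc n. \<bar>c (P k) - c (P (Suc k))\<bar>)"
    by (rule order_trans[OF sum_abs]) (simp add: abs_minus_commute)
  finally have "\<bar>c x - c y\<bar> powr s \<le> (\<Sum>k<Suc n. \<bar>c (P k) - c (P (Suc k))\<bar>) powr s"
    using s by (intro powr_mono2) auto
  also have "\<dots> \<le> real (card {..<Suc n}) powr (s - 1) * (\<Sum>k<Suc n. \<bar>c (P k) - c (P (Suc k))\<bar> powr s)"
    by (intro sum_powr_le s) auto
  finally have "ennreal (\<bar>c x - c y\<bar> powr s)
      \<le> ennreal (real (Suc n) powr (s - 1)) * (\<Sum>k<Suc n. ennreal (\<bar>c (P k) - c (P (Suc k))\<bar> powr s))"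
    by (simp only: sum_ennreal powr_ge_zero card_lessThan ennreal_mult'[symmetric]) (rule ennreal_leI)
  also have "\<dots> \<le> ennreal (real (Suc n) powr (s - 1)) *
      (\<Sum>k<Suc n. ennreal (2 powr (s - 1)) * K * (energy (P k) + energy (P (Suc k))))"
    by (intro mult_left_mono sum_mono step) simp
  also have "\<dots> = ennreal ((2 * real (Suc n)) powr (s - 1)) * K *
      ((\<Sum>k<Suc n. energy (P k)) + (\<Sum>k<Suc n. energy (P (Suc k))))"
    by (simp only: sum_distrib_left[symmetric] sum.distrib powr_mult ennreal_mult' powr_ge_zero mult_ac)
  also have "\<dots> \<le> ennreal ((5 / 2 * R) powr (s - 1)) * K * (ennreal 3 * ?G + ennreal 3 * ?G)"
  proof (intro mult_mono add_mono)
    show "ennreal ((2 * real (Suc n)) powr (s - 1)) \<le> ennreal ((5 / 2 * R) powr (s - 1))"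
      using n dR R s by (intro ennreal_leI powr_mono2) auto
    have "(\<Sum>k<Suc n. energy (P k)) \<le> (\<Sum>k\<le>Suc n. energy (P k))"
      by (intro sum_mono2) auto
    then show "(\<Sum>k<Suc n. energy (P k)) \<le> ennreal 3 * ?G"
      using sum3 by (rule order_trans)
    have "(\<Sum>k<Suc n. energy (P (Suc k))) \<le> (\<Sum>k\<le>Suc n. energy (P k))"
      unfolding lessThan_Suc_atMost sum.atMost_Suc_shift by simp
    then show "(\<Sum>k<Suc n. energy (P (Suc k))) \<le> ennreal 3 * ?G"
      using sum3 by (rule order_trans)
  qed simp_all
  also have "ennreal 3 * ?G + ennreal 3 * ?G = ennreal 6 * ?G"
    by (simp flip: distrib_right ennreal_plus)
  finally show ?thesis
    by (simp add: ennreal_mult' mult_ac)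
qed

text \<open>On the unit ball around \<open>p\<close>, \<open>u - c x\<close> is split at
  \<open>c p\<close>: the local inequality gives the summand 1, and
  \<open>\<bar>c x - c p\<bar> powr s\<close> times the volume gives the summand with
  \<open>V\<close>. Each ball is charged the whole energy of \<open>B(x, R + 1)\<close>, whence the
  factor \<open>card S\<close>.\<close>

lemma covered_ball:
  assumes x: "x \<in> M" and R: "4 \<le> R" and S: "finite S" "S \<subseteq> mball x R"
    and cover: "mball x R \<subseteq> (\<Union>p\<in>S. mball p 1)"
    and vol: "\<And>p. p \<in> M \<Longrightarrow> emeasure \<mu> (mball p 1) \<le> ennreal V" and V: "0 \<le> V"
  shows "(\<integral>\<^sup>+z\<in>mball x R. ennreal (\<bar>u z - c x\<bar> powr s) \<partial>\<mu>)
    \<le> ennreal (real (card S) * 2 powr (s - 1) * (1 + V * 6 * (5 / 2 * R) powr (s - 1))) * K *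
      (\<integral>\<^sup>+z\<in>mball x (R + 1). h z \<partial>\<mu>)"
proof -
  let ?G = "\<integral>\<^sup>+z\<in>mball x (R + 1). h z \<partial>\<mu>"
  let ?b = "6 * (5 / 2 * R) powr (s - 1)"
  let ?e = "2 powr (s - 1)"
  have SM: "p \<in> M" if "p \<in> S" for p
    using S(2) that by auto
  have one: "(\<integral>\<^sup>+z\<in>mball p 1. ennreal (\<bar>u z - c x\<bar> powr s) \<partial>\<mu>) \<le> ennreal (?e * (1 + V * ?b)) * K * ?G"
    if p: "p \<in> S" for p
  proof -
    have sub: "mball p 1 \<subseteq> mball x (R + 1)"
      using p S(2) triangle[of x p] by fastforce
    have "(\<integral>\<^sup>+z\<in>mball p 1. ennreal (\<bar>u z - c x\<bar> powr s) \<partial>\<mu>)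
      \<le> (\<integral>\<^sup>+z. ennreal ?e * (ennreal (\<bar>u z - c p\<bar> powr s) * indicator (mball p 1) z
        + ennreal (\<bar>c x - c p\<bar> powr s) * indicator (mball p 1) z) \<partial>\<mu>)"
    proof (rule nn_integral_mono)
      fix z
      have "\<bar>u z - c x\<bar> powr s = \<bar>(u z - c p) + (c p - c x)\<bar> powr s" by simp
      also have "\<dots> \<le> ?e * (\<bar>u z - c p\<bar> powr s + \<bar>c p - c x\<bar> powr s)"
        by (rule abs_add_powr_le[OF s])
      finally have "ennreal (\<bar>u z - c x\<bar> powr s)
          \<le> ennreal ?e * (ennreal (\<bar>u z - c p\<bar> powr s) + ennreal (\<bar>c x - c p\<bar> powr s))"
        by (simp add: abs_minus_commute ennreal_leI flip: ennreal_mult' ennreal_plus)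
      then show "ennreal (\<bar>u z - c x\<bar> powr s) * indicator (mball p 1) z
        \<le> ennreal ?e * (ennreal (\<bar>u z - c p\<bar> powr s) * indicator (mball p 1) z
          + ennreal (\<bar>c x - c p\<bar> powr s) * indicator (mball p 1) z)"
        by (cases "z \<in> mball p 1") (auto simp del: in_mball)
    qed
    also have "\<dots> = ennreal ?e * ((\<integral>\<^sup>+z\<in>mball p 1. ennreal (\<bar>u z - c p\<bar> powr s) \<partial>\<mu>)
        + ennreal (\<bar>c x - c p\<bar> powr s) * emeasure \<mu> (mball p 1))"
      by (simp add: nn_integral_cmult nn_integral_add)
    also have "\<dots> \<le> ennreal ?e * (K * ?G + (ennreal ?b * K * ?G) * ennreal V)"
    proof (intro mult_left_mono add_mono mult_mono)
      have "energy p \<le> ?G"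
        unfolding energy_def using sub by (intro nn_integral_mono mult_left_mono) (auto simp: indicator_def)
      then show "(\<integral>\<^sup>+z\<in>mball p 1. ennreal (\<bar>u z - c p\<bar> powr s) \<partial>\<mu>) \<le> K * ?G"
        using poincare[OF SM[OF p]] unfolding energy_def by (meson mult_left_mono order_trans zero_le)
      show "ennreal (\<bar>c x - c p\<bar> powr s) \<le> ennreal ?b * K * ?G"
        using p S(2) by (intro distant_centres R x SM) auto
    qed (use vol SM p in auto)
    also have "\<dots> = ennreal (?e * (1 + V * ?b)) * K * ?G"
    proof -
      have "ennreal (?e * (1 + V * ?b)) = ennreal ?e * (1 + ennreal V * ennreal ?b)"
        using V by (simp add: ennreal_mult')
      then show ?thesis
        by (simp add: distrib_left distrib_right mult_ac)
    qed
    finally show ?thesis .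
  qed
  have "(\<integral>\<^sup>+z\<in>mball x R. ennreal (\<bar>u z - c x\<bar> powr s) \<partial>\<mu>)
      \<le> (\<integral>\<^sup>+z. (\<Sum>p\<in>S. ennreal (\<bar>u z - c x\<bar> powr s) * indicator (mball p 1) z) \<partial>\<mu>)"
  proof (rule nn_integral_mono)
    fix z
    show "ennreal (\<bar>u z - c x\<bar> powr s) * indicator (mball x R) z
      \<le> (\<Sum>p\<in>S. ennreal (\<bar>u z - c x\<bar> powr s) * indicator (mball p 1) z)"
    proof (cases "z \<in> mball x R")
      case True
      then obtain p where p: "p \<in> S" "z \<in> mball p 1"
        using cover by blast
      have "ennreal (\<bar>u z - c x\<bar> powr s) * indicator (mball p 1) z
          \<le> (\<Sum>p\<in>S. ennreal (\<bar>u z - c x\<bar> powr s) * indicator (mball p 1) z)"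
        using p S(1) by (intro member_le_sum) auto
      then show ?thesis
        using p(2) True by (simp del: in_mball)
    qed (simp del: in_mball)
  qed
  also have "\<dots> = (\<Sum>p\<in>S. \<integral>\<^sup>+z\<in>mball p 1. ennreal (\<bar>u z - c x\<bar> powr s) \<partial>\<mu>)"
    by (intro nn_integral_sum) simp
  also have "\<dots> \<le> (\<Sum>p\<in>S. ennreal (?e * (1 + V * ?b)) * K * ?G)"
    by (intro sum_mono one)
  also have "\<dots> = ennreal (real (card S) * ?e * (1 + V * 6 * (5 / 2 * R) powr (s - 1))) * K * ?G"
    by (simp add: ennreal_mult' ennreal_of_nat_eq_real_of_nat mult_ac)
  finally show ?thesis .
qed

end

section \<open>Local structure of the orbit map\<close>

context isometric_action
begin

interpretation Q: Metric_space "orbit_space M \<Gamma>" "quotient_dist M d \<Gamma>"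
  by (rule Metric_space_quotient)

lemma orbit_map_in [simp]: "x \<in> M \<Longrightarrow> orbit_map \<Gamma> x \<in> orbit_space M \<Gamma>"
  by (simp add: orbit_space_def)

lemma quotient_dist_le: "x \<in> M \<Longrightarrow> y \<in> M \<Longrightarrow>
  quotient_dist M d \<Gamma> (orbit_map \<Gamma> x) (orbit_map \<Gamma> y) \<le> d x y"
  using INF_action_le[OF action_one, of x y] by (simp add: quotient_dist_orbit_map)

text \<open>Properness of the action makes the infimum in the quotient distance a minimum. Hence the
  orbit map sends closed balls, and not only open ones, onto balls of the same radius.\<close>

lemma orbit_representative:
  assumes "x \<in> M" "q \<in> orbit_space M \<Gamma>"
  obtains y where "y \<in> M" "orbit_map \<Gamma> y = q" "d x y = quotient_dist M d \<Gamma> (orbit_map \<Gamma> x) q"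
proof -
  obtain z where z: "z \<in> M" "q = orbit_map \<Gamma> z"
    using assms(2) by (auto simp: orbit_space_def)
  obtain \<gamma> where "\<gamma> \<in> \<Gamma>" "(INF \<gamma>\<in>\<Gamma>. d x (\<gamma> z)) = d x (\<gamma> z)"
    using INF_action_attained[OF assms(1) z(1)] .
  then show ?thesis
    using that[of "\<gamma> z"] z assms(1) by (simp add: action_closed orbit_map_action quotient_dist_orbit_map)
qed

lemma orbit_map_mball: "x \<in> M \<Longrightarrow> orbit_map \<Gamma> ` mball x r = Q.mball (orbit_map \<Gamma> x) r"
proof
  assume x: "x \<in> M"
  then show "orbit_map \<Gamma> ` mball x r \<subseteq> Q.mball (orbit_map \<Gamma> x) r"
    using quotient_dist_le by fastforce
  show "Q.mball (orbit_map \<Gamma> x) r \<subseteq> orbit_map \<Gamma> ` mball x r"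
  proof
    fix q
    assume q: "q \<in> Q.mball (orbit_map \<Gamma> x) r"
    then obtain y where "y \<in> M" "orbit_map \<Gamma> y = q" "d x y = quotient_dist M d \<Gamma> (orbit_map \<Gamma> x) q"
      using orbit_representative[OF x, of q] by auto
    then show "q \<in> orbit_map \<Gamma> ` mball x r"
      using q x by force
  qed
qed

lemma orbit_map_mcball: "x \<in> M \<Longrightarrow> orbit_map \<Gamma> ` mcball x r = Q.mcball (orbit_map \<Gamma> x) r"
proof
  assume x: "x \<in> M"
  then show "orbit_map \<Gamma> ` mcball x r \<subseteq> Q.mcball (orbit_map \<Gamma> x) r"
    using quotient_dist_le by fastforce
  show "Q.mcball (orbit_map \<Gamma> x) r \<subseteq> orbit_map \<Gamma> ` mcball x r"
  proof
    fix q
    assume q: "q \<in> Q.mcball (orbit_map \<Gamma> x) r"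
    then obtain y where "y \<in> M" "orbit_map \<Gamma> y = q" "d x y = quotient_dist M d \<Gamma> (orbit_map \<Gamma> x) q"
      using orbit_representative[OF x, of q] by auto
    then show "q \<in> orbit_map \<Gamma> ` mcball x r"
      using q x by force
  qed
qed

lemma continuous_orbit_map: "continuous_map mtopology Q.mtopology (orbit_map \<Gamma>)"
  unfolding metric_continuous_map[OF Q.Metric_space_axioms]
  using quotient_dist_le by (meson image_subsetI orbit_map_in order_le_less_trans)

lemma systole_le: "\<gamma> \<in> \<Gamma> \<Longrightarrow> \<gamma> \<noteq> (\<lambda>x\<in>M. x) \<Longrightarrow> x \<in> M \<Longrightarrow> systole M d \<Gamma> \<le> ereal (d x (\<gamma> x))"
  unfolding systole_def
  by (intro INF_lower2[of x] INF_lower2[of \<gamma>]) (auto simp: isometry_group_def BijGroup_def)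

text \<open>A nontrivial \<gamma> moves \<open>z\<close> by at least 4, so
  \<open>d y (\<gamma> z)\<close> is at least \<open>4 - d y z\<close>. This is no less than
  \<open>d y z\<close> up to distance 2, which is just enough for two points of a closed unit
  ball.\<close>

lemma quotient_dist_local:
  assumes sys: "4 \<le> systole M d \<Gamma>" and yz: "y \<in> M" "z \<in> M" "d y z \<le> 2"
  shows "quotient_dist M d \<Gamma> (orbit_map \<Gamma> y) (orbit_map \<Gamma> z) = d y z"
proof -
  obtain \<gamma> where \<gamma>: "\<gamma> \<in> \<Gamma>" "(INF \<gamma>\<in>\<Gamma>. d y (\<gamma> z)) = d y (\<gamma> z)"
    using INF_action_attained[OF yz(1,2)] .
  have "d y z \<le> d y (\<gamma> z)"
  proof (cases "\<gamma> = (\<lambda>x\<in>M. x)")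
    case False
    have "ereal 4 \<le> ereal (d z (\<gamma> z))"
      using order_trans[OF sys systole_le[OF \<gamma>(1) False yz(2)]] by simp
    then have "4 \<le> d z (\<gamma> z)" by simp
    then show ?thesis
      using triangle[of z y "\<gamma> z"] yz \<gamma>(1) by (simp add: action_closed commute)
  qed (use yz in simp)
  then show ?thesis
    using \<gamma>(2) quotient_dist_le[OF yz(1,2)] yz by (simp add: quotient_dist_orbit_map)
qed

lemma inj_orbit_map:
  assumes "4 \<le> systole M d \<Gamma>"
  shows "inj_on (orbit_map \<Gamma>) (mcball x 1)"
proof (rule inj_onI)
  fix y z
  assume yz: "y \<in> mcball x 1" "z \<in> mcball x 1" "orbit_map \<Gamma> y = orbit_map \<Gamma> z"
  then have "d y z \<le> 2"
    using triangle[of y x z] by (auto simp: commute)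
  then have "d y z = 0"
    using quotient_dist_local[OF assms, of y z] yz by simp
  then show "y = z"
    using yz by auto
qed

section \<open>The quotient measure on unit balls\<close>

context
  fixes \<nu> :: "'a set measure"
  assumes sys: "4 \<le> systole M d \<Gamma>" and qm: "is_quotient_measure M d \<mu> \<Gamma> \<nu>"
begin

lemma sets_quotient: "sets \<nu> = sets (metric_borel (orbit_space M \<Gamma>) (quotient_dist M d \<Gamma>))"
  using qm by (simp add: is_quotient_measure_def)

lemma space_quotient: "space \<nu> = orbit_space M \<Gamma>"
  using sets_eq_imp_space_eq[OF sets_quotient] Q.space_metric_borel by simp

lemma quotient_mball_sets [measurable]: "Q.mball q r \<in> sets \<nu>"
  using sets_quotient Q.openin_metric_borel[of "Q.mball q r"] by simp

lemma orbit_map_measurable [measurable]: "orbit_map \<Gamma> \<in> \<mu> \<rightarrow>\<^sub>M \<nu>"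
  using continuous_map_metric_borel[OF continuous_orbit_map Q.Metric_space_axioms]
    measurable_cong_sets[OF borel_sets sets_quotient] by simp

text \<open>The definition of the quotient measure uses the larger ball \<open>U\<close>, whose
  radius is a quarter of the systole. Passing from the unit ball to \<open>U\<close> adds no
  preimage of \<open>B\<close>: two distinct points of one orbit, one in the unit ball and one in
  \<open>U\<close>, would be less than \<open>1 + S / 4\<close> apart, hence less than the systole
  \<open>S\<close>.\<close>

lemma quotient_emeasure:
  assumes x: "x \<in> M" and B: "B \<in> sets \<nu>" "B \<subseteq> Q.mball (orbit_map \<Gamma> x) 1"
  shows "emeasure \<nu> B = emeasure \<mu> {z \<in> mball x 1. orbit_map \<Gamma> z \<in> B}"
proof -
  define U where "U = {z \<in> M. ereal (d x z) < systole M d \<Gamma> / 4}"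
  have one: "1 \<le> systole M d \<Gamma> / 4"
    using sys by (cases "systole M d \<Gamma>") auto
  have sub: "mball x 1 \<subseteq> U"
  proof
    fix z
    assume z: "z \<in> mball x 1"
    then have "ereal (d x z) < 1" by simp
    then show "z \<in> U"
      using order_less_le_trans[OF _ one] z by (simp add: U_def)
  qed
  have "B \<subseteq> orbit_map \<Gamma> ` U"
    using sub B(2) orbit_map_mball[OF x, of 1] by blast
  then have "emeasure \<nu> B = emeasure \<mu> {z \<in> U. orbit_map \<Gamma> z \<in> B}"
    using qm x B(1) by (auto simp: is_quotient_measure_def U_def Let_def)
  also have "{z \<in> U. orbit_map \<Gamma> z \<in> B} = {z \<in> mball x 1. orbit_map \<Gamma> z \<in> B}"
  proof -
    have "z \<in> mball x 1" if z: "z \<in> U" "orbit_map \<Gamma> z \<in> B" for z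
    proof -
      have zM: "z \<in> M"
        using z by (simp add: U_def)
      have "orbit_map \<Gamma> z \<in> orbit_map \<Gamma> ` mball x 1"
        using z(2) B(2) orbit_map_mball[OF x, of 1] by blast
      then obtain w where w: "w \<in> mball x 1" "orbit_map \<Gamma> z = orbit_map \<Gamma> w"
        by auto
      have "z \<in> orbit_map \<Gamma> w"
        using orbit_map_self[OF zM] w(2) by simp
      then obtain \<gamma> where \<gamma>: "\<gamma> \<in> \<Gamma>" "z = \<gamma> w"
        by (auto simp: orbit_map_def)
      have "\<gamma> = (\<lambda>x\<in>M. x)"
      proof (rule ccontr)
        assume "\<gamma> \<noteq> (\<lambda>x\<in>M. x)"
        then have le: "systole M d \<Gamma> \<le> ereal (d w z)"
          using systole_le[OF \<gamma>(1)] w(1) \<gamma>(2) by auto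
        \<comment> \<open>The displacement by a nontrivial \<gamma> bounds the systole, so it is
          finite here.\<close>
        then obtain S where S: "systole M d \<Gamma> = ereal S"
          using sys by (cases "systole M d \<Gamma>") auto
        have "d x z < S / 4"
          using z(1) S by (simp add: U_def)
        then show False
          using le S sys w(1) zM triangle[of w x z] by (auto simp: commute)
      qed
      then show ?thesis
        using \<gamma> w(1) by auto
    qed
    then show ?thesis
      using sub by blast
  qed
  finally show ?thesis .
qed

lemma quotient_emeasure_mball:
  assumes x: "x \<in> M" and r: "r \<le> 1"
  shows "emeasure \<nu> (Q.mball (orbit_map \<Gamma> x) r) = emeasure \<mu> (mball x r)"
proof -
  have "{z \<in> mball x 1. orbit_map \<Gamma> z \<in> Q.mball (orbit_map \<Gamma> x) r} = mball x r"
    using quotient_dist_local[OF sys x] r x by fastforce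
  moreover have "Q.mball (orbit_map \<Gamma> x) r \<subseteq> Q.mball (orbit_map \<Gamma> x) 1"
    using r by auto
  ultimately show ?thesis
    using quotient_emeasure[OF x, of "Q.mball (orbit_map \<Gamma> x) r"] by simp
qed

text \<open>Restricted to the image of the unit ball, \<nu> is the push-forward of the restricted
  \<mu>.\<close>

lemma quotient_nn_integral_mball:
  assumes x: "x \<in> M" and f: "f \<in> borel_measurable \<nu>"
  shows "(\<integral>\<^sup>+q\<in>Q.mball (orbit_map \<Gamma> x) 1. f q \<partial>\<nu>) = (\<integral>\<^sup>+z\<in>mball x 1. f (orbit_map \<Gamma> z) \<partial>\<mu>)"
proof -
  let ?p = "orbit_map \<Gamma>"
  let ?N = "restrict_space \<nu> (Q.mball (?p x) 1)" and ?W = "restrict_space \<mu> (mball x 1)"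
  have p: "?p \<in> ?W \<rightarrow>\<^sub>M ?N"
    using orbit_map_mball[OF x, of 1] by (intro measurable_restrict_space3 orbit_map_measurable) blast
  have "?N = distr ?W ?N ?p"
  proof (rule measure_eqI)
    fix B
    assume "B \<in> sets ?N"
    then have B: "B \<in> sets \<nu>" "B \<subseteq> Q.mball (?p x) 1"
      by (auto simp: sets_restrict_space_iff)
    have "?p -` B \<inter> space ?W = {z \<in> mball x 1. ?p z \<in> B}"
      by (auto simp: space_restrict_space space_eq)
    moreover have "{z \<in> mball x 1. ?p z \<in> B} \<subseteq> mball x 1"
      by auto
    ultimately show "emeasure ?N B = emeasure (distr ?W ?N ?p) B"
      using \<open>B \<in> sets ?N\<close> B quotient_emeasure[OF x B] by (simp add: emeasure_distr[OF p] emeasure_restrict_space)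
  qed simp
  then have "integral\<^sup>N ?N f = integral\<^sup>N (distr ?W ?N ?p) f"
    by simp
  also have "\<dots> = (\<integral>\<^sup>+z. f (?p z) \<partial>?W)"
    using f by (intro nn_integral_distr p) (simp add: measurable_restrict_space1)
  finally show ?thesis
    by (simp add: nn_integral_restrict_space)
qed

end

end

section \<open>Lifting the Poincare inequality\<close>

lemma curve_length_isometry:
  assumes "\<And>r t. r \<in> {a..b} \<Longrightarrow> t \<in> {a..b} \<Longrightarrow> d' (c' r) (c' t) = d (c r) (c t)"
  shows "curve_length d' c' a b = curve_length d c a b"
  unfolding curve_length_def
proof (rule SUP_cong[OF refl], rule sum.cong[OF refl])
  fix ts i
  assume "ts \<in> {ts. sorted ts \<and> set ts \<subseteq> {a..b}}" "i \<in> {..<length ts - 1}"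
  then have "ts ! i \<in> set ts" "ts ! Suc i \<in> set ts" "set ts \<subseteq> {a..b}"
    by auto
  then have "ts ! i \<in> {a..b}" "ts ! Suc i \<in> {a..b}"
    by blast+
  then show "ennreal (d' (c' (ts ! i)) (c' (ts ! Suc i))) = ennreal (d (c (ts ! i)) (c (ts ! Suc i)))"
    using assms by simp
qed

lemma curve_length_ge:
  assumes "a \<le> b"
  shows "ennreal (d (c a) (c b)) \<le> curve_length d c a b"
  unfolding curve_length_def using assms by (intro SUP_upper2[of "[a, b]"]) auto

text \<open>A path that visits an open set stays there for a positive time; cutting the interval at
  0 and 1 leaves positive length because \<open>t\<close> lies in \<open>{0..1}\<close>. So a
  function that is infinite on \<open>U\<close> has infinite integral along the path.\<close>

lemma pathin_avoids_nonnull: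
  assumes c: "pathin X c" and U: "openin X U" and t: "t \<in> {0..1}" "c t \<in> U"
  obtains J where "J \<in> sets lborel" "J \<subseteq> {0..1}" "0 < emeasure lborel J" "\<And>r. r \<in> J \<Longrightarrow> c r \<in> U"
proof -
  have "openin (top_of_set {0..1}) {r \<in> {0..1}. c r \<in> U}"
    using openin_continuous_map_preimage[OF c[unfolded pathin_def] U] by simp
  then obtain T where T: "open T" "{r \<in> {0..1}. c r \<in> U} = {0..1} \<inter> T"
    by (auto simp: openin_open)
  then obtain e where e: "0 < e" "\<And>r. dist r t < e \<Longrightarrow> r \<in> T"
    using t open_dist[of T] by blast
  let ?J = "{max 0 (t - e / 2)..min 1 (t + e / 2)}"
  show ?thesis
  proof
    show "0 < emeasure lborel ?J"
      using t(1) e(1) by (auto simp: emeasure_lborel_Icc_eq max_def min_def)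
    show "c r \<in> U" if "r \<in> ?J" for r
    proof -
      have "r \<in> {0..1} \<inter> T"
        using that t(1) e(1) by (auto simp: dist_real_def intro!: e(2))
      then show ?thesis
        using T(2) by blast
    qed
  qed auto
qed

context isometric_action
begin

interpretation Q: Metric_space "orbit_space M \<Gamma>" "quotient_dist M d \<Gamma>"
  by (rule Metric_space_quotient)

text \<open>The section lives on the closed unit ball for two reasons: Tietze's theorem extends from
  closed sets, and a path that leaves a closed set spends positive time outside.\<close>

context
  fixes x :: 'a and sec :: "'a set \<Rightarrow> 'a"
  assumes sys: "4 \<le> systole M d \<Gamma>" and x: "x \<in> M"
  defines "sec \<equiv> inv_into (mcball x 1) (orbit_map \<Gamma>)"
begin

lemma sec_orbit_map: "z \<in> mcball x 1 \<Longrightarrow> sec (orbit_map \<Gamma> z) = z"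
  unfolding sec_def by (rule inv_into_f_f[OF inj_orbit_map[OF sys]])

lemma sec_isometry:
  assumes "q \<in> Q.mcball (orbit_map \<Gamma> x) 1" "r \<in> Q.mcball (orbit_map \<Gamma> x) 1"
  shows "d (sec q) (sec r) = quotient_dist M d \<Gamma> q r"
proof -
  obtain y z where yz: "y \<in> mcball x 1" "q = orbit_map \<Gamma> y" "z \<in> mcball x 1" "r = orbit_map \<Gamma> z"
    using assms unfolding orbit_map_mcball[OF x, symmetric] by blast
  have "d y z \<le> 2"
    using yz triangle[of y x z] by (auto simp: commute)
  then show ?thesis
    using quotient_dist_local[OF sys, of y z] yz sec_orbit_map by simp
qed

lemma sec_in: "q \<in> Q.mcball (orbit_map \<Gamma> x) 1 \<Longrightarrow> sec q \<in> mcball x 1"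
  unfolding orbit_map_mcball[OF x, symmetric] sec_def by (rule inv_into_into)

lemma continuous_sec:
  "continuous_map (subtopology Q.mtopology (Q.mcball (orbit_map \<Gamma> x) 1)) mtopology sec"
proof -
  interpret A: Submetric "orbit_space M \<Gamma>" "quotient_dist M d \<Gamma>" "Q.mcball (orbit_map \<Gamma> x) 1"
    by unfold_locales auto
  have "continuous_map A.sub.mtopology mtopology sec"
    unfolding A.sub.metric_continuous_map[OF Metric_space_axioms]
  proof (intro conjI ballI allI impI)
    show "sec ` Q.mcball (orbit_map \<Gamma> x) 1 \<subseteq> M"
      using sec_in mcball_subset_mspace by blast
    show "\<exists>\<delta>>0. \<forall>r. r \<in> Q.mcball (orbit_map \<Gamma> x) 1 \<and> quotient_dist M d \<Gamma> q r < \<delta>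
        \<longrightarrow> d (sec q) (sec r) < e"
      if "q \<in> Q.mcball (orbit_map \<Gamma> x) 1" "0 < e" for q and e :: real
      by (rule exI[of _ e]) (use that sec_isometry in \<open>simp del: Q.in_mcball\<close>)
  qed
  then show ?thesis
    by (simp only: A.mtopology_submetric)
qed

lemma sec_measurable:
  "sec \<in> restrict_space (metric_borel (orbit_space M \<Gamma>) (quotient_dist M d \<Gamma>)) (Q.mball (orbit_map \<Gamma> x) 1)
    \<rightarrow>\<^sub>M metric_borel M d" (is "_ \<in> ?N \<rightarrow>\<^sub>M _")
  unfolding metric_borel_def[of M]
proof (rule measurable_measure_of)
  let ?B = "Q.mball (orbit_map \<Gamma> x) 1" and ?A = "Q.mcball (orbit_map \<Gamma> x) 1"
  have sp: "space ?N = ?B"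
    by (auto simp: space_restrict_space Q.space_metric_borel)
  show "{U. openin mtopology U} \<subseteq> Pow M"
    using openin_subset by fastforce
  show "sec \<in> space ?N \<rightarrow> M"
    using sec_in mcball_subset_mspace sp Q.mball_subset_mcball by blast
  show "sec -` U \<inter> space ?N \<in> sets ?N" if "U \<in> {U. openin mtopology U}" for U
  proof -
    have "openin (subtopology Q.mtopology ?A) {q \<in> ?A. sec q \<in> U}"
      using openin_continuous_map_preimage[OF continuous_sec, of U] that
      by (simp add: Q.mcball_subset_mspace Int_absorb1)
    then obtain T where T: "openin Q.mtopology T" "{q \<in> ?A. sec q \<in> U} = T \<inter> ?A"
      by (auto simp: openin_subtopology)
    have "sec -` U \<inter> space ?N = T \<inter> ?B"
      using T(2) Q.mball_subset_mcball unfolding sp by blast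
    then show ?thesis
      using T(1) Q.openin_metric_borel[of T] Q.openin_metric_borel[of ?B]
      by (auto simp: sets_restrict_space)
  qed
qed

text \<open>Making the gradient infinite off the open ball disposes of the curves that leave the closed
  ball, on which the orbit map can be inverted; inside the closed ball curves are lifted.\<close>

lemma upper_gradient_descend:
  assumes g: "upper_gradient M d u g"
    and v: "\<And>q. q \<in> Q.mcball (orbit_map \<Gamma> x) 1 \<Longrightarrow> v q = u (sec q)"
  shows "upper_gradient (orbit_space M \<Gamma>) (quotient_dist M d \<Gamma>) v
    (\<lambda>q. if q \<in> Q.mball (orbit_map \<Gamma> x) 1 then g (sec q) else \<infinity>)" (is "upper_gradient _ ?q v ?g")
  unfolding upper_gradient_def
proof (intro conjI allI impI)
  let ?B = "Q.mball (orbit_map \<Gamma> x) 1" and ?A = "Q.mcball (orbit_map \<Gamma> x) 1"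
  have g_borel: "g \<in> borel_measurable (metric_borel M d)"
    using g by (simp add: upper_gradient_def)
  have B: "?B \<inter> space (metric_borel (orbit_space M \<Gamma>) ?q) \<in> sets (metric_borel (orbit_space M \<Gamma>) ?q)"
    using Q.openin_metric_borel[of ?B] by auto
  show "?g \<in> borel_measurable (metric_borel (orbit_space M \<Gamma>) ?q)"
  proof (subst measurable_If_restrict_space_iff)
    show "{q \<in> space (metric_borel (orbit_space M \<Gamma>) ?q). q \<in> ?B} \<in> sets (metric_borel (orbit_space M \<Gamma>) ?q)"
      using B by (simp add: Int_def conj_commute)
    show "(\<lambda>q. g (sec q)) \<in> borel_measurable (restrict_space (metric_borel (orbit_space M \<Gamma>) ?q) {q. q \<in> ?B})
      \<and> (\<lambda>q. \<infinity>) \<in> borel_measurable (restrict_space (metric_borel (orbit_space M \<Gamma>) ?q) {q. q \<notin> ?B})"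
      using measurable_compose[OF sec_measurable g_borel] by (simp del: Q.in_mball)
  qed
  fix c
  assume c: "pathin Q.mtopology c \<and> curve_length ?q c 0 1 < \<infinity> \<and> constant_speed ?q c"
  let ?L = "curve_length ?q c 0 1"
  have cQ: "c t \<in> orbit_space M \<Gamma>" if "t \<in> {0..1}" for t
    using c continuous_map_image_subset_topspace that unfolding pathin_def by fastforce
  show "ennreal \<bar>v (c 1) - v (c 0)\<bar> \<le> ?L * (\<integral>\<^sup>+t\<in>{0..1}. ?g (c t) \<partial>lborel)"
  \<comment> \<open>Touching the boundary sphere does no harm: the lifted curve still exists there,
    and the value \<infinity> of \<open>?g\<close> only enlarges the right-hand side.\<close>
  proof (cases "\<forall>t\<in>{0..1}. c t \<in> ?A")
    case True
    let ?c = "sec \<circ> c"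
    have len: "curve_length d ?c a b = curve_length ?q c a b" if "0 \<le> a" "b \<le> 1" for a b
    proof (rule curve_length_isometry)
      fix r t
      assume "r \<in> {a..b}" "t \<in> {a..b}"
      then have "r \<in> {0..1}" "t \<in> {0..1}"
        using that by auto
      then have "c r \<in> ?A" "c t \<in> ?A"
        using True by blast+
      then show "d (?c r) (?c t) = ?q (c r) (c t)"
        using sec_isometry by simp
    qed
    have "continuous_map (subtopology euclideanreal {0..1}) (subtopology Q.mtopology ?A) c"
      using c True by (auto simp: pathin_def continuous_map_in_subtopology simp del: Q.in_mcball)
    then have "pathin mtopology ?c"
      unfolding pathin_def using continuous_sec by (rule continuous_map_compose)
    moreover have "constant_speed d ?c"
      unfolding constant_speed_def
    proof (intro allI impI)
      fix r t :: real
      assume rt: "0 \<le> r \<and> r \<le> t \<and> t \<le> 1"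
      then have "curve_length ?q c r t = ennreal (t - r) * ?L"
        using c unfolding constant_speed_def by blast
      then show "curve_length d ?c r t = ennreal (t - r) * curve_length d ?c 0 1"
        using len[of r t] len[of 0 1] rt by (simp only: order_refl zero_le_one)
    qed
    moreover have "curve_length d ?c 0 1 < \<infinity>"
      using c len by simp
    ultimately have "ennreal \<bar>u (?c 1) - u (?c 0)\<bar>
        \<le> curve_length d ?c 0 1 * (\<integral>\<^sup>+t\<in>{0..1}. g (?c t) \<partial>lborel)"
      using g unfolding upper_gradient_def by blast
    also have "\<dots> \<le> ?L * (\<integral>\<^sup>+t\<in>{0..1}. ?g (c t) \<partial>lborel)"
      using len by (intro mult_mono nn_integral_mono) auto
    finally show ?thesis
      using True v by (simp del: Q.in_mcball)
  next
    case False
    then obtain t where t: "t \<in> {0..1}" "c t \<in> orbit_space M \<Gamma> - ?A"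
      using cQ by blast
    have "openin Q.mtopology (orbit_space M \<Gamma> - ?A)"
      using Q.closedin_mcball[of "orbit_map \<Gamma> x" 1] by (auto simp: closedin_def)
    then obtain J where J: "J \<in> sets lborel" "J \<subseteq> {0..1}" "0 < emeasure lborel J"
        "\<And>r. r \<in> J \<Longrightarrow> c r \<in> orbit_space M \<Gamma> - ?A"
      using pathin_avoids_nonnull[where c = c, OF _ _ t] c by blast
    have "\<infinity> = (\<integral>\<^sup>+t. \<infinity> * indicator J t \<partial>lborel)"
      using J(3) by (simp only: nn_integral_cmult_indicator[OF J(1)]) (simp add: ennreal_top_mult)
    also have "\<dots> \<le> (\<integral>\<^sup>+t\<in>{0..1}. ?g (c t) \<partial>lborel)"
    proof (intro nn_integral_mono)
      fix r
      show "\<infinity> * indicator J r \<le> ?g (c r) * indicator {0..1} r"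
      proof (cases "r \<in> J")
        case True
        then have "c r \<notin> ?B" "r \<in> {0..1}"
          using J(2,4) Q.mball_subset_mcball by blast+
        then show ?thesis by (simp del: Q.in_mball)
      qed simp
    qed
    finally have inf: "(\<integral>\<^sup>+t\<in>{0..1}. ?g (c t) \<partial>lborel) = \<infinity>"
      by (simp add: top_unique)
    \<comment> \<open>Since \<open>0 * \<infinity> = 0\<close>, the infinite integral says nothing
      about a curve of length 0; such a curve has equal end points.\<close>
    show ?thesis
    proof (cases "?L = 0")
      case True
      then have "?q (c 0) (c 1) = 0"
        using curve_length_ge[of 0 1 ?q c] Q.nonneg[of "c 0" "c 1"] by simp
      then have "c 0 = c 1"
        using cQ by simp
      then show ?thesis by simp
    next
      case False
      then show ?thesis
        unfolding inf by (simp add: ennreal_mult_top)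
    qed
  qed
qed

text \<open>Premise and conclusion leave the constant \<open>a\<close> open: the average over the
  ball of the orbit space can be inserted, and the same number serves above, without comparing
  averages through the orbit map.\<close>

lemma lifted_poincare:
  fixes \<nu> :: "'a set measure" and K :: ennreal and s :: real
  assumes qm: "is_quotient_measure M d \<mu> \<Gamma> \<nu>"
    and u: "continuous_map mtopology euclideanreal u" and g: "upper_gradient M d u g"
    and poincare: "\<And>v g. continuous_map Q.mtopology euclideanreal v \<Longrightarrow>
      upper_gradient (orbit_space M \<Gamma>) (quotient_dist M d \<Gamma>) v g \<Longrightarrow>
      \<exists>a. (\<integral>\<^sup>+q\<in>Q.mball (orbit_map \<Gamma> x) 1. ennreal (\<bar>v q - a\<bar> powr s) \<partial>\<nu>)
        \<le> K * (\<integral>\<^sup>+q\<in>Q.mball (orbit_map \<Gamma> x) 1. ennreal_powr (g q) s \<partial>\<nu>)"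
  shows "\<exists>a. (\<integral>\<^sup>+z\<in>mball x 1. ennreal (\<bar>u z - a\<bar> powr s) \<partial>\<mu>)
    \<le> K * (\<integral>\<^sup>+z\<in>mball x 1. ennreal_powr (g z) s \<partial>\<mu>)"
proof -
  let ?A = "Q.mcball (orbit_map \<Gamma> x) 1" and ?B = "Q.mball (orbit_map \<Gamma> x) 1"
  have "continuous_map (subtopology Q.mtopology ?A) euclideanreal (u \<circ> sec)"
    using continuous_sec u by (rule continuous_map_compose)
  then obtain v where v: "continuous_map Q.mtopology euclideanreal v" "\<And>q. q \<in> ?A \<Longrightarrow> v q = (u \<circ> sec) q"
    using Tietze_extension_realinterval[OF Q.normal_space_mtopology Q.closedin_mcball, of UNIV]
    by (metis UNIV_not_empty is_interval_univ subset_UNIV)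
  let ?g = "\<lambda>q. if q \<in> ?B then g (sec q) else \<infinity>"
  have ug: "upper_gradient (orbit_space M \<Gamma>) (quotient_dist M d \<Gamma>) v ?g"
    using g v(2) by (intro upper_gradient_descend) (auto simp del: Q.in_mcball)
  obtain a where a: "(\<integral>\<^sup>+q\<in>?B. ennreal (\<bar>v q - a\<bar> powr s) \<partial>\<nu>) \<le> K * (\<integral>\<^sup>+q\<in>?B. ennreal_powr (?g q) s \<partial>\<nu>)"
    using poincare[OF v(1) ug] by blast
  have gm: "?g \<in> borel_measurable \<nu>"
    using ug measurable_cong_sets[OF sets_quotient[OF sys qm] refl] unfolding upper_gradient_def by blast
  have vm: "v \<in> borel_measurable \<nu>"
    using Q.continuous_map_real_metric_borel[OF v(1)]
      measurable_cong_sets[OF sets_quotient[OF sys qm] refl] by blast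
  have pz: "orbit_map \<Gamma> z \<in> ?B" "sec (orbit_map \<Gamma> z) = z" "v (orbit_map \<Gamma> z) = u z" if "z \<in> mball x 1" for z
  proof -
    show B: "orbit_map \<Gamma> z \<in> ?B"
      using that orbit_map_mball[OF x, of 1] by blast
    show sec: "sec (orbit_map \<Gamma> z) = z"
      using that mball_subset_mcball by (intro sec_orbit_map) blast
    show "v (orbit_map \<Gamma> z) = u z"
      using v(2)[of "orbit_map \<Gamma> z"] B sec Q.mball_subset_mcball by auto
  qed
  have "(\<integral>\<^sup>+z\<in>mball x 1. ennreal (\<bar>u z - a\<bar> powr s) \<partial>\<mu>)
      = (\<integral>\<^sup>+z\<in>mball x 1. ennreal (\<bar>v (orbit_map \<Gamma> z) - a\<bar> powr s) \<partial>\<mu>)"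
    using pz by (intro nn_integral_cong) (auto simp: indicator_def simp del: in_mball)
  also have "\<dots> = (\<integral>\<^sup>+q\<in>?B. ennreal (\<bar>v q - a\<bar> powr s) \<partial>\<nu>)"
    using vm by (intro quotient_nn_integral_mball[OF sys qm x, symmetric]) measurable
  also note a
  also have "(\<integral>\<^sup>+q\<in>?B. ennreal_powr (?g q) s \<partial>\<nu>)
      = (\<integral>\<^sup>+z\<in>mball x 1. ennreal_powr (?g (orbit_map \<Gamma> z)) s \<partial>\<mu>)"
    by (intro quotient_nn_integral_mball[OF sys qm x] ennreal_powr_measurable gm)
  also have "\<dots> = (\<integral>\<^sup>+z\<in>mball x 1. ennreal_powr (g z) s \<partial>\<mu>)"
    using pz by (intro nn_integral_cong) (auto simp: indicator_def simp del: in_mball Q.in_mball)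
  finally show ?thesis by blast
qed

end

end

section \<open>Counting and the global inequality\<close>

text \<open>The factor \<open>2 powr \<sigma>\<close> pays for the passage to the average, the rest
  is the constant of \<open>covered_ball\<close>. Enlarging \<open>5 / 2\<close> to 4 gives
  \<open>2 powr (2 * \<sigma> - 2) * R powr (\<sigma> - 1)\<close>, and
  \<open>7 * V \<le> 2 * lam ^ 4\<close> because \<open>lam\<close> is at least 2 and at least
  \<open>V\<close>. The exponents of 2 then add up: \<open>1 + \<sigma> + (\<sigma> - 1) + (2 *
  \<sigma> - 2) = 4 * \<sigma> - 2\<close>.\<close>

lemma poincare_constant_le:
  fixes V D lam N F R \<sigma> :: real
  assumes V: "1 \<le> V" and D: "1 \<le> D" and lam: "lam = V + D" and N: "N \<le> V * F" "0 \<le> F"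
    and R: "1 \<le> R" and \<sigma>: "1 \<le> \<sigma>"
  shows "2 powr \<sigma> * (N * 2 powr (\<sigma> - 1) * (1 + V * 6 * (5 / 2 * R) powr (\<sigma> - 1)))
    \<le> 2 powr (4 * \<sigma> - 2) * (V * lam ^ 4 * R powr (\<sigma> - 1) * F)"
proof -
  define A where "A = (5 / 2 * R) powr (\<sigma> - 1)"
  have A1: "1 \<le> A"
    using R \<sigma> by (simp add: A_def ge_one_powr_ge_zero)
  have "A \<le> (4 * R) powr (\<sigma> - 1)"
    unfolding A_def using R \<sigma> by (intro powr_mono2) auto
  also have "\<dots> = (2 powr 2) powr (\<sigma> - 1) * R powr (\<sigma> - 1)"
    using R by (simp add: powr_mult)
  also have "\<dots> = 2 powr (2 * \<sigma> - 2) * R powr (\<sigma> - 1)"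
    by (simp only: powr_powr) (simp add: algebra_simps)
  finally have A4: "A \<le> 2 powr (2 * \<sigma> - 2) * R powr (\<sigma> - 1)" .
  have "1 * 1 \<le> V * A"
    using V A1 by (intro mult_mono) auto
  then have "1 + V * 6 * A \<le> 7 * V * A"
    by (simp add: algebra_simps)
  also have "\<dots> \<le> 7 * V * (2 powr (2 * \<sigma> - 2) * R powr (\<sigma> - 1))"
    using V A4 by (intro mult_left_mono) auto
  finally have B: "1 + V * 6 * A \<le> 7 * V * (2 powr (2 * \<sigma> - 2) * R powr (\<sigma> - 1))" .
  have "2 * 2 * 2 \<le> lam * lam * lam"
    using V D lam by (intro mult_mono) auto
  then have "8 * V \<le> (lam * lam * lam) * lam"
    using V D lam by (intro mult_mono) auto
  then have l4: "7 * V \<le> 2 * lam ^ 4"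
    using V by (simp add: power4_eq_xxxx mult.assoc)
  have "N * (2 powr (\<sigma> - 1) * (1 + V * 6 * A))
      \<le> (V * F) * (2 powr (\<sigma> - 1) * (7 * V * (2 powr (2 * \<sigma> - 2) * R powr (\<sigma> - 1))))"
    using N B V A1 by (intro mult_mono mult_left_mono) auto
  also have "\<dots> = (7 * V) * (V * F * 2 powr (\<sigma> - 1) * 2 powr (2 * \<sigma> - 2) * R powr (\<sigma> - 1))"
    by simp
  also have "\<dots> \<le> (2 * lam ^ 4) * (V * F * 2 powr (\<sigma> - 1) * 2 powr (2 * \<sigma> - 2) * R powr (\<sigma> - 1))"
    using l4 V N(2) by (intro mult_right_mono) auto
  finally have "2 powr \<sigma> * (N * (2 powr (\<sigma> - 1) * (1 + V * 6 * A)))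
      \<le> 2 powr \<sigma> * ((2 * lam ^ 4) * (V * F * 2 powr (\<sigma> - 1) * 2 powr (2 * \<sigma> - 2) * R powr (\<sigma> - 1)))"
    by (rule mult_left_mono) simp
  also have "\<dots> = (2 powr 1 * 2 powr \<sigma> * 2 powr (\<sigma> - 1) * 2 powr (2 * \<sigma> - 2))
      * (V * lam ^ 4 * R powr (\<sigma> - 1) * F)"
    by simp
  also have "2 powr 1 * 2 powr \<sigma> * 2 powr (\<sigma> - 1) * 2 powr (2 * \<sigma> - 2) = (2::real) powr (4 * \<sigma> - 2)"
    by (simp only: powr_add[symmetric]) (simp add: algebra_simps)
  finally show ?thesis
    by (simp add: A_def mult.assoc)
qed

section \<open>Orbit growth and separated sets\<close>

context isometric_action
begin

interpretation Q: Metric_space "orbit_space M \<Gamma>" "quotient_dist M d \<Gamma>"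
  by (rule Metric_space_quotient)

text \<open>Since \<open>card\<close> of an infinite set is 0, lower bounds on \<open>growth\<close>
  depend on this.\<close>

lemma finite_growth: "finite (orbit_map \<Gamma> x \<inter> (mtopology closure_of mball x T))"
proof (cases "x \<in> M \<and> 0 < T")
  case True
  have "mtopology closure_of mball x T \<subseteq> mcball x T"
    by (intro closure_of_minimal mball_subset_mcball closedin_mcball)
  then have "orbit_map \<Gamma> x \<inter> (mtopology closure_of mball x T)
      \<subseteq> (\<lambda>\<gamma>. \<gamma> x) ` {\<gamma> \<in> \<Gamma>. \<gamma> ` mcball x T \<inter> mcball x T \<noteq> {}}"
    using True by (fastforce simp: orbit_map_def)
  then show ?thesis
    using proper_action[OF proper, of x T] True finite_subset by blast
next
  case False
  then have "mball x T = {}"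
    by (metis mball_eq_empty not_less)
  then show ?thesis by simp
qed

lemma growth_pos:
  assumes "x \<in> M" "0 < T"
  shows "1 \<le> growth M d \<Gamma> x T"
proof -
  have "x \<in> mtopology closure_of mball x T"
    using closure_of_subset[of "mball x T" mtopology] assms by (auto simp: subset_iff)
  then have "x \<in> orbit_map \<Gamma> x \<inter> (mtopology closure_of mball x T)"
    using orbit_map_self assms by simp
  then show ?thesis
    unfolding growth_def using finite_growth card_gt_0_iff by (metis Suc_leI One_nat_def empty_iff)
qed

text \<open>By freeness an element is determined by its value at one point: the inverse of \<delta>
  composed with \<gamma> fixes \<open>x\<close>.\<close>

lemma action_eqI:
  assumes "\<gamma> \<in> \<Gamma>" "\<delta> \<in> \<Gamma>" "x \<in> M" "\<gamma> x = \<delta> x" "z \<in> M"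
  shows "\<gamma> z = \<delta> z"
proof -
  obtain \<epsilon> where \<epsilon>: "\<epsilon> \<in> \<Gamma>" "\<And>x. x \<in> M \<Longrightarrow> \<epsilon> (\<delta> x) = x" "\<And>x. x \<in> M \<Longrightarrow> \<delta> (\<epsilon> x) = x"
    using action_inverse[OF assms(2)] by metis
  have "compose M \<epsilon> \<gamma> x = x"
    using assms \<epsilon>(2) by (simp add: compose_def)
  then have "compose M \<epsilon> \<gamma> = \<one>\<^bsub>isometry_group M d\<^esub>"
    using free_action[OF action_compose[OF \<epsilon>(1) assms(1)] _ assms(3)] by blast
  then have "compose M \<epsilon> \<gamma> z = z"
    using assms(5) by (simp add: isometry_group_def BijGroup_def)
  then have "\<epsilon> (\<gamma> z) = z"
    using assms(5) by (simp add: compose_def)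
  then show ?thesis
    using \<epsilon>(3)[of "\<gamma> z"] action_closed[OF assms(1,5)] by simp
qed

context
  fixes \<nu> :: "'a set measure" and V D :: real
  assumes sys: "4 \<le> systole M d \<Gamma>" and qm: "is_quotient_measure M d \<mu> \<Gamma> \<nu>"
    and half_ball: "\<And>x. x \<in> M \<Longrightarrow> 1 \<le> emeasure \<mu> (mball x (1 / 2))"
    and diam: "\<And>q r. q \<in> orbit_space M \<Gamma> \<Longrightarrow> r \<in> orbit_space M \<Gamma> \<Longrightarrow> quotient_dist M d \<Gamma> q r \<le> D"
    and vol: "emeasure \<nu> (orbit_space M \<Gamma>) \<le> ennreal V"
begin

lemma orbit_space_sets: "orbit_space M \<Gamma> \<in> sets \<nu>"
  by (metis sets.top space_quotient[OF sys qm])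

lemma mball_volume_le:
  assumes "x \<in> M" "r \<le> 1"
  shows "emeasure \<mu> (mball x r) \<le> ennreal V"
proof -
  have "emeasure \<mu> (mball x r) = emeasure \<nu> (Q.mball (orbit_map \<Gamma> x) r)"
    by (rule quotient_emeasure_mball[OF sys qm assms, symmetric])
  also have "\<dots> \<le> emeasure \<nu> (orbit_space M \<Gamma>)"
    by (rule emeasure_mono[OF Q.mball_subset_mspace orbit_space_sets])
  finally show ?thesis
    using vol by (rule order_trans)
qed

lemma volume_ge_1:
  assumes "x \<in> M"
  shows "1 \<le> V"
proof -
  have "1 \<le> ennreal V"
    using order_trans[OF half_ball[OF assms] mball_volume_le[OF assms]] by simp
  then show ?thesis
    by simp
qed

text \<open>A point of the orbit space lies in the images of at most \<open>growth\<close> many of the disjoint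
  half balls, so integrating over the orbit space bounds their number.\<close>

lemma separated_card_le:
  assumes x: "x \<in> M" and S: "finite S" "S \<subseteq> mball x R"
    and sep: "\<And>i j. i \<in> S \<Longrightarrow> j \<in> S \<Longrightarrow> i \<noteq> j \<Longrightarrow> 1 \<le> d i j" and T: "R + 1 / 2 + D \<le> T"
  shows "real (card S) \<le> V * real (growth M d \<Gamma> x T)"
proof -
  let ?B = "\<lambda>i. Q.mball (orbit_map \<Gamma> i) (1 / 2)"
  have SM: "i \<in> M" "d x i < R" if "i \<in> S" for i
    using S(2) that by auto
  have card: "real (card {i \<in> S. q \<in> ?B i}) \<le> real (growth M d \<Gamma> x T)" if "q \<in> space \<nu>" for q
  proof -
    have q: "q \<in> orbit_space M \<Gamma>"
      using that space_quotient[OF sys qm] by simp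
    \<comment> \<open>\<open>growth\<close> counts the orbit of \<open>x\<close>, not
      \<open>q\<close> itself. A representative \<open>z\<close> within \<open>D\<close> of
      \<open>x\<close> makes it possible to replace \<open>\<phi> i z\<close> by
      \<open>\<phi> i x\<close> below.\<close>
    obtain z where z: "z \<in> M" "orbit_map \<Gamma> z = q" "d x z = quotient_dist M d \<Gamma> (orbit_map \<Gamma> x) q"
      using orbit_representative[OF x q] .
    have xz: "d x z \<le> D"
      using z(3) diam q x by simp
    let ?I = "{i \<in> S. q \<in> ?B i}"
    have "\<forall>i\<in>?I. \<exists>\<gamma>. \<gamma> \<in> \<Gamma> \<and> d i (\<gamma> z) < 1 / 2"
    proof
      fix i
      assume i: "i \<in> ?I"
      have "q \<in> orbit_map \<Gamma> ` mball i (1 / 2)"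
        using i orbit_map_mball[of i "1 / 2"] SM by blast
      then obtain w where w: "w \<in> mball i (1 / 2)" "orbit_map \<Gamma> w = q"
        by auto
      then have "w \<in> orbit_map \<Gamma> z"
        using orbit_map_self[of w] z(2) by simp
      then show "\<exists>\<gamma>. \<gamma> \<in> \<Gamma> \<and> d i (\<gamma> z) < 1 / 2"
        using w(1) by (auto simp: orbit_map_def)
    qed
    from bchoice[OF this]
    obtain \<phi> where \<phi>: "\<And>i. i \<in> ?I \<Longrightarrow> \<phi> i \<in> \<Gamma>" "\<And>i. i \<in> ?I \<Longrightarrow> d i (\<phi> i z) < 1 / 2"
      by blast
    \<comment> \<open>Freeness turns equality at \<open>x\<close> into equality at \<open>z\<close>;
      then the half balls around \<open>i\<close> and \<open>j\<close> share a point, which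
      separation forbids for \<open>i \<noteq> j\<close>.\<close>
    have inj: "inj_on (\<lambda>i. \<phi> i x) ?I"
    proof (rule inj_onI)
      fix i j
      assume ij: "i \<in> ?I" "j \<in> ?I" "\<phi> i x = \<phi> j x"
      then have "\<phi> i z = \<phi> j z"
        using action_eqI[OF \<phi>(1) \<phi>(1) x _ z(1)] by blast
      moreover have "\<phi> j z \<in> M"
        using \<phi>(1)[OF ij(2)] z(1) action_closed by blast
      moreover have "i \<in> S" "j \<in> S"
        using ij by blast+
      ultimately have "d i j < 1"
        using \<phi>(2)[OF ij(1)] \<phi>(2)[OF ij(2)] triangle[of i "\<phi> j z" j] SM(1) commute[of j]
        by fastforce
      then show "i = j"
        using sep[of i j] \<open>i \<in> S\<close> \<open>j \<in> S\<close> by linarith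
    qed
    have sub: "(\<lambda>i. \<phi> i x) ` ?I \<subseteq> orbit_map \<Gamma> x \<inter> (mtopology closure_of mball x T)"
    proof (intro image_subsetI IntI)
      fix i
      assume i: "i \<in> ?I"
      show "\<phi> i x \<in> orbit_map \<Gamma> x"
        using \<phi>(1)[OF i] by (simp add: orbit_map_def)
      have iS: "i \<in> S"
        using i by blast
      have M: "i \<in> M" "\<phi> i z \<in> M" "\<phi> i x \<in> M"
        by (rule SM(1)[OF iS] action_closed[OF \<phi>(1)[OF i]] z(1) x)+
      have "d (\<phi> i z) (\<phi> i x) = d z x"
        using action_isometry[OF \<phi>(1)[OF i] z(1) x] .
      \<comment> \<open>The route from \<open>x\<close> over \<open>i\<close> and
        \<open>\<phi> i z\<close> to \<open>\<phi> i x\<close> explains the three terms in the bound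
        on \<open>T\<close>.\<close>
      then have "d x (\<phi> i x) < R + 1 / 2 + D"
        using triangle[OF x M(1,2)] triangle[OF x M(2,3)] SM(2)[OF iS] \<phi>(2)[OF i] xz
          commute[of z x] by linarith
      then have "\<phi> i x \<in> mball x T"
        using T x M by simp
      then show "\<phi> i x \<in> mtopology closure_of mball x T"
        by (metis closure_of_subset mball_subset_mspace subsetD topspace_mtopology)
    qed
    show ?thesis
      using card_inj_on_le[OF inj sub finite_growth] unfolding growth_def by (rule of_nat_mono)
  qed
  \<comment> \<open>Each projected half ball still has volume at least 1, so the cardinality is at
    most the volume counted with multiplicity.\<close>
  have "ennreal (real (card S)) = (\<Sum>i\<in>S. 1)"
    by (simp add: ennreal_of_nat_eq_real_of_nat)
  also have "\<dots> \<le> (\<Sum>i\<in>S. emeasure \<nu> (?B i))"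
  proof (rule sum_mono)
    fix i
    assume "i \<in> S"
    then show "1 \<le> emeasure \<nu> (?B i)"
      using half_ball[OF SM(1)] by (simp add: quotient_emeasure_mball[OF sys qm SM(1)])
  qed
  also have "\<dots> = (\<Sum>i\<in>S. \<integral>\<^sup>+q\<in>?B i. 1 \<partial>\<nu>)"
    by (simp add: quotient_mball_sets[OF sys qm])
  also have "\<dots> \<le> ennreal (real (growth M d \<Gamma> x T)) * (\<integral>\<^sup>+q\<in>orbit_space M \<Gamma>. 1 \<partial>\<nu>)"
    by (rule nn_integral_sum_indicator_le[OF _ quotient_mball_sets[OF sys qm] S(1) card
          Q.mball_subset_mspace orbit_space_sets]) auto
  also have "\<dots> \<le> ennreal (real (growth M d \<Gamma> x T)) * ennreal V"
    using vol by (intro mult_left_mono) (simp_all add: orbit_space_sets)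
  finally have "ennreal (real (card S)) \<le> ennreal (V * real (growth M d \<Gamma> x T))"
    by (simp add: ennreal_mult'' mult.commute)
  moreover have "0 \<le> V"
    using volume_ge_1[OF x] by simp
  ultimately show ?thesis
    by (subst (asm) ennreal_le_iff) auto
qed

text \<open>The bound on separated sets also yields the existence of a maximal one: take one of
  greatest cardinality. An uncovered point of the ball could be added to it.\<close>

lemma unit_net:
  assumes x: "x \<in> M" and T: "R + 1 / 2 + D \<le> T"
  obtains S where "finite S" "S \<subseteq> mball x R" "mball x R \<subseteq> (\<Union>p\<in>S. mball p 1)"
    "real (card S) \<le> V * real (growth M d \<Gamma> x T)"
proof -
  define P where "P S \<longleftrightarrow> finite S \<and> S \<subseteq> mball x R \<and> (\<forall>i\<in>S. \<forall>j\<in>S. i \<noteq> j \<longrightarrow> 1 \<le> d i j)" for S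
  have card: "real (card S) \<le> V * real (growth M d \<Gamma> x T)" if "P S" for S
    using that by (intro separated_card_le[OF x _ _ _ T]) (auto simp: P_def)
  have "card S < Suc (nat \<lfloor>V * real (growth M d \<Gamma> x T)\<rfloor>)" if "P S" for S
    using card[OF that] by (simp add: le_nat_floor less_Suc_eq_le)
  moreover have "P {}"
    by (simp add: P_def)
  ultimately obtain S where S: "P S" "\<And>S'. P S' \<Longrightarrow> card S' \<le> card S"
    using ex_has_greatest_nat[of P "{}" card] by metis
  have "mball x R \<subseteq> (\<Union>p\<in>S. mball p 1)"
  proof
    fix y
    assume y: "y \<in> mball x R"
    show "y \<in> (\<Union>p\<in>S. mball p 1)"
    proof (rule ccontr)
      assume "y \<notin> (\<Union>p\<in>S. mball p 1)"
      then have far: "1 \<le> d p y" if "p \<in> S" for p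
        using that y S(1) by (force simp: P_def)
      then have "y \<notin> S"
        using y by fastforce
      moreover have "P (insert y S)"
        using S(1) y far by (auto simp: P_def commute)
      ultimately show False
        using S(2)[of "insert y S"] S(1) by (simp add: P_def)
    qed
  qed
  then show ?thesis
    using that[of S] S(1) card[OF S(1)] unfolding P_def by blast
qed

text \<open>The geodesic to \<open>y\<close> passes through a point at distance exactly 1 from
  \<open>x\<close>, a distance that the orbit map preserves.\<close>

lemma diameter_ge_1:
  assumes x: "x \<in> M" and y: "y \<in> M" "1 \<le> d x y"
  shows "1 \<le> D"
proof -
  obtain e where e: "e \<in> {0..d x y} \<rightarrow> M" "e 0 = x" "e (d x y) = y"
      "\<And>a b. a \<in> {0..d x y} \<Longrightarrow> b \<in> {0..d x y} \<Longrightarrow> d (e a) (e b) = \<bar>a - b\<bar>"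
    using geodesic[OF x y(1)] by blast
  have z: "e 1 \<in> M" "d x (e 1) = 1"
    using e(1) e(4)[of 0 1] e(2) y(2) by auto
  then show ?thesis
    using quotient_dist_local[OF sys x z(1)] diam[of "orbit_map \<Gamma> x" "orbit_map \<Gamma> (e 1)"] x by simp
qed

lemma poincare_large_balls:
  fixes K :: ennreal and s lam R :: real
  assumes s: "1 \<le> s" and lam: "lam = V + D" and R: "4 * lam \<le> R" and x: "x \<in> M"
    and u: "continuous_map mtopology euclideanreal u" and g: "g \<in> borel_measurable \<mu>"
    and poincare: "\<And>p. p \<in> M \<Longrightarrow> \<exists>a. (\<integral>\<^sup>+z\<in>mball p 1. ennreal (\<bar>u z - a\<bar> powr s) \<partial>\<mu>)
      \<le> K * (\<integral>\<^sup>+z\<in>mball p 1. ennreal_powr (g z) s \<partial>\<mu>)"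
  shows "(\<integral>\<^sup>+z\<in>mball x R. ennreal (\<bar>u z - ball_average M d \<mu> u R x\<bar> powr s) \<partial>\<mu>)
    \<le> ennreal (2 powr (4 * s - 2)) * K *
      ennreal (V * lam ^ 4 * R powr (s - 1) * real (growth M d \<Gamma> x (2 * lam * R))) *
      (\<integral>\<^sup>+z\<in>mball x (2 * lam * R). ennreal_powr (g z) s \<partial>\<mu>)"
proof -
  have "\<forall>p\<in>M. \<exists>a. (\<integral>\<^sup>+z\<in>mball p 1. ennreal (\<bar>u z - a\<bar> powr s) \<partial>\<mu>)
      \<le> K * (\<integral>\<^sup>+z\<in>mball p 1. ennreal_powr (g z) s \<partial>\<mu>)"
    using poincare by (rule ballI)
  from bchoice[OF this] obtain c where c: "\<And>p. p \<in> M \<Longrightarrow> (\<integral>\<^sup>+z\<in>mball p 1. ennreal (\<bar>u z - c p\<bar> powr s) \<partial>\<mu>)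
      \<le> K * (\<integral>\<^sup>+z\<in>mball p 1. ennreal_powr (g z) s \<partial>\<mu>)"
    by blast
  interpret local_poincare M d \<mu> u "\<lambda>z. ennreal_powr (g z) s" c K s
    using s u g half_ball c
    by unfold_locales (auto intro: continuous_map_borel ennreal_powr_measurable)
  let ?T = "2 * lam * R"
  let ?F = "real (growth M d \<Gamma> x ?T)"
  let ?G = "\<lambda>r. \<integral>\<^sup>+z\<in>mball x r. ennreal_powr (g z) s \<partial>\<mu>"
  let ?av = "ball_average M d \<mu> u R x"
  have V: "1 \<le> V"
    by (rule volume_ge_1[OF x])
  have D: "0 \<le> D"
    using diam[of "orbit_map \<Gamma> x" "orbit_map \<Gamma> x"] x by simp
  have lam1: "1 \<le> lam" and R4: "4 \<le> R"
    using V D lam R by auto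
  have DR: "D \<le> D * R" "R \<le> V * R"
    using V D R4 mult_left_mono[of 1 R D] mult_right_mono[of 1 V R] by auto
  have T: "?T = 2 * (V * R) + 2 * (D * R)"
    by (simp add: lam algebra_simps)
  \<comment> \<open>The radius \<open>2 * lam * R\<close> is at least \<open>2 * R + 2 * D\<close>,
    which covers the radius \<open>R + 1\<close> of the energy as well as the radius
    \<open>R + 1 / 2 + D\<close> of the count.\<close>
  have T_ge: "R + 1 \<le> ?T" "1 \<le> ?T" "R + 1 / 2 + D \<le> ?T"
    using DR R4 D T by linarith+
  have mono: "?G r \<le> ?G ?T" if "r \<le> ?T" for r
    using that by (intro nn_integral_mono mult_left_mono) (auto simp: indicator_def)
  have F: "1 \<le> ?F"
    using growth_pos[OF x, of ?T] lam1 R4 by simp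
  have "0 < emeasure \<mu> (mball x R)"
  proof -
    have "mball x (1 / 2) \<subseteq> mball x R"
      using R4 by auto
    then have "1 \<le> emeasure \<mu> (mball x R)"
      using order_trans[OF half_ball[OF x] emeasure_mono] by simp
    then show ?thesis
      by (rule order_less_le_trans[rotated]) simp
  qed
  then have centre: "(\<integral>\<^sup>+z\<in>mball x R. ennreal (\<bar>u z - ?av\<bar> powr s) \<partial>\<mu>)
      \<le> ennreal (2 powr s) * (\<integral>\<^sup>+z\<in>mball x R. ennreal (\<bar>u z - c x\<bar> powr s) \<partial>\<mu>)"
    by (rule ball_average_powr_le[OF u x s])
  \<comment> \<open>\<open>A\<close> is the constant obtained with \<open>c x\<close> in place of
    the average; the second conjunct reserves the factor \<open>2 powr s\<close> of
    \<open>centre\<close>.\<close>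
  have "\<exists>A. (\<integral>\<^sup>+z\<in>mball x R. ennreal (\<bar>u z - c x\<bar> powr s) \<partial>\<mu>) \<le> ennreal A * K * ?G ?T \<and>
      2 powr s * A \<le> 2 powr (4 * s - 2) * (V * lam ^ 4 * R powr (s - 1) * ?F)"
  proof (cases "\<exists>y\<in>M. 1 \<le> d x y")
    case True
    then have D1: "1 \<le> D"
      using diameter_ge_1[OF x] by blast
    obtain S where S: "finite S" "S \<subseteq> mball x R" "mball x R \<subseteq> (\<Union>p\<in>S. mball p 1)"
        "real (card S) \<le> V * ?F"
      using unit_net[OF x T_ge(3)] by blast
    let ?A = "real (card S) * 2 powr (s - 1) * (1 + V * 6 * (5 / 2 * R) powr (s - 1))"
    have "(\<integral>\<^sup>+z\<in>mball x R. ennreal (\<bar>u z - c x\<bar> powr s) \<partial>\<mu>) \<le> ennreal ?A * K * ?G (R + 1)"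
      using S V mball_volume_le by (intro covered_ball x R4) auto
    also have "\<dots> \<le> ennreal ?A * K * ?G ?T"
      by (intro mult_left_mono mono T_ge) simp
    finally show ?thesis
      using poincare_constant_le[OF V D1 lam S(4) _ _ s, of R] R4 by auto
  next
    case False
    \<comment> \<open>Here the whole space lies in the unit ball around \<open>x\<close>, and
      \<open>D\<close> may be arbitrarily small. The local inequality at \<open>x\<close> suffices
      with \<open>A = 1\<close>, all factors of the target constant being at least 1.\<close>
    then have ball: "mball x R = mball x 1"
      using R4 by force
    have "(\<integral>\<^sup>+z\<in>mball x R. ennreal (\<bar>u z - c x\<bar> powr s) \<partial>\<mu>) \<le> K * ?G 1"
      unfolding ball by (rule c[OF x])
    also have "\<dots> \<le> K * ?G ?T"
      by (intro mult_left_mono mono T_ge) simp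
    also have "\<dots> = ennreal 1 * K * ?G ?T"
      by simp
    finally have "(\<integral>\<^sup>+z\<in>mball x R. ennreal (\<bar>u z - c x\<bar> powr s) \<partial>\<mu>) \<le> ennreal 1 * K * ?G ?T" .
    moreover have "1 * 1 * 1 * 1 \<le> V * lam ^ 4 * R powr (s - 1) * ?F"
      using V lam1 R4 s F by (intro mult_mono one_le_power ge_one_powr_ge_zero) auto
    then have "2 powr s * 1 \<le> 2 powr (4 * s - 2) * (V * lam ^ 4 * R powr (s - 1) * ?F)"
      using s by (intro mult_mono powr_mono) auto
    ultimately show ?thesis by blast
  qed
  then obtain A where A: "(\<integral>\<^sup>+z\<in>mball x R. ennreal (\<bar>u z - c x\<bar> powr s) \<partial>\<mu>) \<le> ennreal A * K * ?G ?T"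
      "2 powr s * A \<le> 2 powr (4 * s - 2) * (V * lam ^ 4 * R powr (s - 1) * ?F)"
    by blast
  note centre
  also have "ennreal (2 powr s) * (\<integral>\<^sup>+z\<in>mball x R. ennreal (\<bar>u z - c x\<bar> powr s) \<partial>\<mu>)
      \<le> ennreal (2 powr s) * (ennreal A * K * ?G ?T)"
    by (intro mult_left_mono A(1)) simp
  also have "\<dots> = ennreal (2 powr s * A) * (K * ?G ?T)"
    by (simp add: ennreal_mult' mult.assoc)
  also have "\<dots> \<le> ennreal (2 powr (4 * s - 2) * (V * lam ^ 4 * R powr (s - 1) * ?F)) * (K * ?G ?T)"
    by (intro mult_right_mono ennreal_leI A(2)) simp
  also have "\<dots> = ennreal (2 powr (4 * s - 2)) * K * ennreal (V * lam ^ 4 * R powr (s - 1) * ?F) * ?G ?T"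
    by (subst ennreal_mult') (simp_all add: mult_ac)
  finally show ?thesis .
qed

end

end

theorem theorem6p1:
  fixes M :: "'a set" and d :: "'a \<Rightarrow> 'a \<Rightarrow> real" and \<mu> :: "'a measure"
    and \<Gamma> :: "('a \<Rightarrow> 'a) set" and \<nu> :: "'a set measure"
    and D V\<^sub>0 \<sigma> lam :: real and CR :: "real \<Rightarrow> real" and C :: ennreal
  assumes action: "isometric_action M d \<mu> \<Gamma>"
    and compact_quotient:
      "compact_space (Metric_space.mtopology (orbit_space M \<Gamma>) (quotient_dist M d \<Gamma>))"
    and systole: "4 \<le> systole M d \<Gamma>"
    and ball_volume: "\<And>x. x \<in> M \<Longrightarrow> 1 \<le> emeasure \<mu> (Metric_space.mball M d x (1 / 2))"
    and quotient_measure: "is_quotient_measure M d \<mu> \<Gamma> \<nu>"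
    and diameter: "metric_diameter (orbit_space M \<Gamma>) (quotient_dist M d \<Gamma>) \<le> ereal D"
    and volume: "emeasure \<nu> (orbit_space M \<Gamma>) \<le> ennreal V\<^sub>0"
    and sigma: "1 \<le> \<sigma>"
    and poincare_pos: "\<And>R. 0 < R \<Longrightarrow> ereal R \<le> systole M d \<Gamma> / 4 \<Longrightarrow> 0 < CR R"
    and poincare: "\<And>R v g y. 0 < R \<Longrightarrow> ereal R \<le> systole M d \<Gamma> / 4 \<Longrightarrow>
      continuous_map (Metric_space.mtopology (orbit_space M \<Gamma>) (quotient_dist M d \<Gamma>))
        euclideanreal v \<Longrightarrow>
      upper_gradient (orbit_space M \<Gamma>) (quotient_dist M d \<Gamma>) v g \<Longrightarrow>
      y \<in> orbit_space M \<Gamma> \<Longrightarrow>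
      (\<integral>\<^sup>+z\<in>Metric_space.mball (orbit_space M \<Gamma>) (quotient_dist M d \<Gamma>) y R.
          ennreal (\<bar>v z - ball_average (orbit_space M \<Gamma>) (quotient_dist M d \<Gamma>) \<nu> v R y\<bar> powr \<sigma>) \<partial>\<nu>)
      \<le> ennreal (CR R) *
        (\<integral>\<^sup>+z\<in>Metric_space.mball (orbit_space M \<Gamma>) (quotient_dist M d \<Gamma>) y R.
          ennreal_powr (g z) \<sigma> \<partial>\<nu>)"
    and C_def: "C = (SUP R\<in>{R. 0 < R \<and> ereal R \<le> systole M d \<Gamma> / 4}. ennreal (CR R))"
    and lam_def: "lam = V\<^sub>0 + D"
  shows "\<forall>u g x R.
      continuous_map (Metric_space.mtopology M d) euclideanreal u \<longrightarrow>
      upper_gradient M d u g \<longrightarrow> x \<in> M \<longrightarrow> 4 * lam \<le> R \<longrightarrow>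
      (\<integral>\<^sup>+z\<in>Metric_space.mball M d x R. ennreal (\<bar>u z - ball_average M d \<mu> u R x\<bar> powr \<sigma>) \<partial>\<mu>)
      \<le> ennreal (2 powr (4 * \<sigma> - 2)) * C *
        ennreal (V\<^sub>0 * lam ^ 4 * R powr (\<sigma> - 1) * real (growth M d \<Gamma> x (2 * lam * R))) *
        (\<integral>\<^sup>+z\<in>Metric_space.mball M d x (2 * lam * R). ennreal_powr (g z) \<sigma> \<partial>\<mu>)"
proof (intro allI impI)
  fix u g x R
  assume u: "continuous_map (Metric_space.mtopology M d) euclideanreal u"
    and g: "upper_gradient M d u g" and x: "x \<in> M" and R: "4 * lam \<le> R"
  interpret isometric_action M d \<mu> \<Gamma> by fact
  interpret Q: Metric_space "orbit_space M \<Gamma>" "quotient_dist M d \<Gamma>"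
    by (rule Metric_space_quotient)
  \<comment> \<open>A systole of at least 4 is exactly what makes 1 an admissible radius.\<close>
  have one: "ereal 1 \<le> systole M d \<Gamma> / 4"
    using systole by (cases "systole M d \<Gamma>") auto
  have diam: "quotient_dist M d \<Gamma> q r \<le> D" if "q \<in> orbit_space M \<Gamma>" "r \<in> orbit_space M \<Gamma>" for q r
  proof -
    have "ereal (quotient_dist M d \<Gamma> q r) \<le> metric_diameter (orbit_space M \<Gamma>) (quotient_dist M d \<Gamma>)"
      unfolding metric_diameter_def using that by (intro SUP_upper2[of q] SUP_upper2[of r]) auto
    then show ?thesis
      using diameter order_trans by fastforce
  qed
  have g_borel: "g \<in> borel_measurable \<mu>"
    using g measurable_cong_sets[OF borel_sets refl] unfolding upper_gradient_def by blast
  have local: "\<exists>a. (\<integral>\<^sup>+z\<in>mball p 1. ennreal (\<bar>u z - a\<bar> powr \<sigma>) \<partial>\<mu>)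
      \<le> ennreal (CR 1) * (\<integral>\<^sup>+z\<in>mball p 1. ennreal_powr (g z) \<sigma> \<partial>\<mu>)" if p: "p \<in> M" for p
  proof (rule lifted_poincare[OF systole p quotient_measure u g])
    fix v g
    assume v: "continuous_map Q.mtopology euclideanreal v"
      and g: "upper_gradient (orbit_space M \<Gamma>) (quotient_dist M d \<Gamma>) v g"
    show "\<exists>a. (\<integral>\<^sup>+q\<in>Q.mball (orbit_map \<Gamma> p) 1. ennreal (\<bar>v q - a\<bar> powr \<sigma>) \<partial>\<nu>)
        \<le> ennreal (CR 1) * (\<integral>\<^sup>+q\<in>Q.mball (orbit_map \<Gamma> p) 1. ennreal_powr (g q) \<sigma> \<partial>\<nu>)"
      using poincare[OF _ one v g orbit_map_in[OF p]] by auto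
  qed
  have "ennreal (CR 1) \<le> C"
    unfolding C_def using one by (intro SUP_upper) auto
  then have "ennreal (2 powr (4 * \<sigma> - 2)) * ennreal (CR 1) * a * b \<le> ennreal (2 powr (4 * \<sigma> - 2)) * C * a * b"
    for a b
    by (intro mult_right_mono mult_left_mono) auto
  with poincare_large_balls[OF systole quotient_measure ball_volume diam volume sigma lam_def R x u g_borel local]
  show "(\<integral>\<^sup>+z\<in>mball x R. ennreal (\<bar>u z - ball_average M d \<mu> u R x\<bar> powr \<sigma>) \<partial>\<mu>)
      \<le> ennreal (2 powr (4 * \<sigma> - 2)) * C *
        ennreal (V\<^sub>0 * lam ^ 4 * R powr (\<sigma> - 1) * real (growth M d \<Gamma> x (2 * lam * R))) *
        (\<integral>\<^sup>+z\<in>mball x (2 * lam * R). ennreal_powr (g z) \<sigma> \<partial>\<mu>)"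
    by (rule order_trans)
qed

end
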